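(* Let $V$ be a finite-dimensional real vector space and let $\sigma$ be the Weierstrass sigma function of the lattice $\Lambda=\mathbb{Z}\omega_1+\mathbb{Z}\omega_2$ with $\omega_1=1-i$, $\omega_2=1+i$: $$\sigma(z)=z\prod_{(k_1,k_2)\neq(0,0)}\Big(1-\frac{z}{k_1\omega_1+k_2\omega_2}\Big)\exp\Big[\frac{z}{k_1\omega_1+k_2\omega_2}+\frac12\Big(\frac{z}{k_1\omega_1+k_2\omega_2}\Big)^2\Big].$$ If $E,T\in\mathrm{End}_{\mathbb{R}}(V)$ satisfy $$[E,T]=0,\quad \sin(\pi E)=0,\quad \sinh(\pi T)=0,\quad \sin\!\Big(\frac{\pi}{2}(E^2+T^2)\Big)=0,$$ then $S:=E+T$ satisfies $\sigma(S)=0$. Conversely, every $S\in\mathrm{End}_{\mathbb{R}}(V)$ with $\sigma(S)=0$ determines a unique pair $(E,T)$ of endomorphisms in $\mathrm{End}_{\mathbb{R}}(V)$ such that $S=E+T$ and $E,T$ satisfy the four conditions above.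
   Context: For an endomorphism $A$ of $V$ and an entire function $f(z)=\sum a_k z^k$, $f(A)$ denotes $\sum a_k A^k$ (convergent since $f$ is entire); $[E,T]=ET-TE$. *)

theory Defs
  imports "HOL-Complex_Analysis.Complex_Analysis"
begin

text \<open>
  The product runs over the nonzero pairs of integers and is unordered: it is the limit of the
  partial products along the directed set of finite sets of indices (as for \<open>infsum\<close>).
\<close>

definition weierstrass_sigma :: "complex \<Rightarrow> complex \<Rightarrow> complex \<Rightarrow> complex" where
  "weierstrass_sigma \<omega>\<^sub>1 \<omega>\<^sub>2 z =
     z * Lim (finite_subsets_at_top (UNIV - {(0, 0)}))
           (\<lambda>F. \<Prod>(k\<^sub>1, k\<^sub>2) \<in> F.
              let u = z / (of_int k\<^sub>1 * \<omega>\<^sub>1 + of_int k\<^sub>2 * \<omega>\<^sub>2)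
              in (1 - u) * exp (u + (1 / 2) * u ^ 2))"

abbreviation \<sigma> :: "complex \<Rightarrow> complex" where
  "\<sigma> \<equiv> weierstrass_sigma (1 - \<i>) (1 + \<i>)"

text \<open>
  \<open>fun_of_end f A\<close> is $f(A) = \sum_k a_k A^k$, with $a_k$ the Taylor coefficients of \<open>f\<close> at the
  origin. The series converges in the canonical topology of the finite-dimensional real space,
  i.e. after applying any linear functional; no norm on the space has to be chosen. The
  coefficients are complex numbers a priori, so the scalar series is summed in the complex
  numbers. They are real for all functions used here (for \<open>\<sigma>\<close> because the lattice is
  stable under conjugation), and then the sum exists by \<open>ex1_fun_of_end\<close> below.
\<close>

definition fun_of_end :: "(complex \<Rightarrow> complex) \<Rightarrow> ('v::real_vector \<Rightarrow> 'v) \<Rightarrow> 'v \<Rightarrow> 'v" where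
  "fun_of_end f A v =
     (THE w. \<forall>\<phi>::'v \<Rightarrow> real. linear \<phi> \<longrightarrow>
        (\<lambda>k. fps_nth (fps_expansion f 0) k * complex_of_real (\<phi> ((A ^^ k) v)))
          sums complex_of_real (\<phi> w))"

lemma ex1_fun_of_end:
  fixes A :: "'v::real_vector \<Rightarrow> 'v"
  assumes fin: "\<exists>B::'v set. finite B \<and> span B = UNIV"
    and A: "linear A"
    and f: "f holomorphic_on UNIV"
    and real: "\<And>k. fps_nth (fps_expansion f 0) k \<in> \<real>"
  shows "\<exists>!w. \<forall>\<phi>::'v \<Rightarrow> real. linear \<phi> \<longrightarrow>
           (\<lambda>k. fps_nth (fps_expansion f 0) k * complex_of_real (\<phi> ((A ^^ k) v)))
             sums complex_of_real (\<phi> w)"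
proof -
  obtain B0 :: "'v set" where B0: "finite B0" "span B0 = UNIV" using fin by blast
  obtain B where B: "B \<subseteq> B0" "independent B" "B0 \<subseteq> span B"
    using maximal_independent_subset[of B0] by blast
  have finB: "finite B" using B B0 finite_subset by blast
  have spB: "span B = UNIV" using B B0 by (metis span_minimal subspace_span top.extremum_uniqueI)
  define R where "R = representation B"
  have linR: "linear (\<lambda>v. R v b)" for b
    unfolding R_def using B(2) spB
    by (intro linearI) (auto simp: real_vector.representation_add real_vector.representation_scale)
  have R_eq: "(\<Sum>b\<in>B. R x b *\<^sub>R b) = x" for x
    unfolding R_def by (rule real_vector.sum_representation_eq) (use B spB finB in auto)
  define N where "N x = (\<Sum>b\<in>B. \<bar>R x b\<bar>)" for x
  have N_ge: "\<bar>R x b\<bar> \<le> N x" if "b \<in> B" for x b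
    unfolding N_def using that finB by (intro member_le_sum) auto
  have N_pos: "0 \<le> N x" for x by (simp add: N_def sum_nonneg)
  define M where "M = (\<Sum>b\<in>B. N (A b))"
  have M_pos: "0 \<le> M" unfolding M_def by (simp add: sum_nonneg N_pos)
  have N_A: "N (A x) \<le> M * N x" for x
  proof -
    have "A x = (\<Sum>b\<in>B. R x b *\<^sub>R A b)"
      by (subst (1) R_eq[of x, symmetric]) (simp add: linear_sum[OF A] linear_scale[OF A])
    hence "R (A x) c = (\<Sum>b\<in>B. R x b * R (A b) c)" for c
      by (simp add: linear_sum[OF linR] linear_scale[OF linR])
    hence "N (A x) \<le> (\<Sum>c\<in>B. \<Sum>b\<in>B. \<bar>R x b * R (A b) c\<bar>)"
      unfolding N_def by (intro sum_mono) (simp)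
    also have "\<dots> = (\<Sum>b\<in>B. \<bar>R x b\<bar> * N (A b))"
      by (subst sum.swap) (simp only: N_def sum_distrib_left abs_mult)
    also have "\<dots> \<le> (\<Sum>b\<in>B. N x * N (A b))"
      by (intro sum_mono mult_right_mono N_ge N_pos)
    finally show ?thesis by (simp add: M_def sum_distrib_left mult.commute)
  qed
  have N_pow: "N ((A ^^ k) v) \<le> M ^ k * N v" for k
  proof (induction k)
    case (Suc k)
    have "N ((A ^^ Suc k) v) \<le> M * N ((A ^^ k) v)" using N_A by simp
    also have "\<dots> \<le> M * (M ^ k * N v)" by (intro mult_left_mono Suc M_pos)
    finally show ?case by (simp add: mult_ac)
  qed simp
  define a where "a k = fps_nth (fps_expansion f 0) k" for k
  define r where "r k = Re (a k)" for k
  have a_r: "a k = complex_of_real (r k)" for k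
    using real[of k] by (simp add: a_def r_def)
  have "fps_conv_radius (fps_expansion f 0) \<ge> \<infinity>"
    using f by (intro conv_radius_fps_expansion) auto
  hence "summable (\<lambda>k. norm (a k * complex_of_real M ^ k))"
    unfolding a_def by (intro abs_summable_in_conv_radius) (simp add: fps_conv_radius_def)
  hence sumM: "summable (\<lambda>k. \<bar>r k\<bar> * M ^ k * N v)"
    using M_pos by (intro summable_mult2) (simp add: a_r norm_mult norm_power)
  have summ: "summable (\<lambda>k. r k * R ((A ^^ k) v) b)" if "b \<in> B" for b
  proof (rule summable_comparison_test'[OF sumM])
    fix k
    have "\<bar>R ((A ^^ k) v) b\<bar> \<le> M ^ k * N v"
      using N_ge[OF that] N_pow order_trans by blast
    thus "norm (r k * R ((A ^^ k) v) b) \<le> \<bar>r k\<bar> * M ^ k * N v"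
      by (simp add: abs_mult mult.assoc mult_left_mono)
  qed
  define w where "w = (\<Sum>b\<in>B. (\<Sum>k. r k * R ((A ^^ k) v) b) *\<^sub>R b)"
  have w_sums: "(\<lambda>k. r k * \<phi> ((A ^^ k) v)) sums \<phi> w" if phi: "linear \<phi>" for \<phi> :: "'v \<Rightarrow> real"
  proof -
    have phi_R: "\<phi> x = (\<Sum>b\<in>B. R x b * \<phi> b)" for x
      by (subst (1) R_eq[of x, symmetric]) (simp add: linear_sum[OF phi] linear_scale[OF phi])
    have *: "r k * \<phi> ((A ^^ k) v) = (\<Sum>b\<in>B. r k * R ((A ^^ k) v) b * \<phi> b)" for k
      by (subst phi_R) (simp only: sum_distrib_left mult.assoc)
    have "\<phi> w = (\<Sum>b\<in>B. (\<Sum>k. r k * R ((A ^^ k) v) b) * \<phi> b)"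
      by (simp add: w_def linear_sum[OF phi] linear_scale[OF phi])
    thus ?thesis
      unfolding * by (auto intro!: sums_sum sums_mult2 summable_sums summ)
  qed
  show ?thesis
  proof (rule ex1I[of _ w])
    show "\<forall>\<phi>::'v \<Rightarrow> real. linear \<phi> \<longrightarrow>
            (\<lambda>k. fps_nth (fps_expansion f 0) k * complex_of_real (\<phi> ((A ^^ k) v)))
              sums complex_of_real (\<phi> w)"
    proof (intro allI impI)
      fix \<phi> :: "'v \<Rightarrow> real" assume "linear \<phi>"
      from sums_of_real[OF w_sums[OF this], where 'a = complex]
      show "(\<lambda>k. fps_nth (fps_expansion f 0) k * complex_of_real (\<phi> ((A ^^ k) v)))
              sums complex_of_real (\<phi> w)"
        by (simp add: a_def[symmetric] a_r)
    qed
  next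
    fix w'
    assume w': "\<forall>\<phi>::'v \<Rightarrow> real. linear \<phi> \<longrightarrow>
            (\<lambda>k. fps_nth (fps_expansion f 0) k * complex_of_real (\<phi> ((A ^^ k) v)))
              sums complex_of_real (\<phi> w')"
    have "R w' b = R w b" for b
    proof -
      have "(\<lambda>k. complex_of_real (r k * R ((A ^^ k) v) b)) sums complex_of_real (R w' b)"
        using w'[rule_format, OF linR[of b]] by (simp add: a_def[symmetric] a_r)
      moreover have "(\<lambda>k. complex_of_real (r k * R ((A ^^ k) v) b)) sums complex_of_real (R w b)"
        using sums_of_real[OF w_sums[OF linR[of b]]] .
      ultimately show ?thesis using sums_unique2 of_real_eq_iff by metis
    qed
    thus "w' = w" using R_eq[of w] R_eq[of w'] by simp
  qed
qed

definition sigma_pair :: "('v::real_vector \<Rightarrow> 'v) \<Rightarrow> ('v \<Rightarrow> 'v) \<Rightarrow> bool" where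
  "sigma_pair E T \<longleftrightarrow>
     (\<lambda>v. E (T v) - T (E v)) = (\<lambda>v. 0) \<and>
     fun_of_end sin (\<lambda>v. pi *\<^sub>R E v) = (\<lambda>v. 0) \<and>
     fun_of_end sinh (\<lambda>v. pi *\<^sub>R T v) = (\<lambda>v. 0) \<and>
     fun_of_end sin (\<lambda>v. (pi / 2) *\<^sub>R ((E ^^ 2) v + (T ^^ 2) v)) = (\<lambda>v. 0)"

end

theory Submission
  imports Defs "HOL-Computational_Algebra.Fundamental_Theorem_Algebra"
begin

text \<open>
  Let $f$ be entire with real Taylor coefficients and only simple zeros. If $f(A) = 0$, then the
  complexification of $V$ is spanned by eigenvectors of $A$ whose eigenvalues are zeros of $f$: on a
  Jordan block $(A - \mu) u = w$, $(A - \mu) w = 0$ one has $f(A) u = f(\mu) u + f'(\mu) w$, and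
  since $f$ and $f'$ do not vanish simultaneously this forces $w = 0$. The converse is clear.

  The function $\sigma$ is of this kind, with zeros exactly at the lattice points $m + \mathrm{i} n$,
  $m \equiv n$ modulo $2$. The four conditions on $(E, T)$ say that the complexification is spanned
  by joint eigenvectors with eigenvalues $(m, \mathrm{i} n)$, where $m^2 - n^2$ is even; these are
  eigenvectors of $E + T$ for the lattice point $m + \mathrm{i} n$. Conversely $E$ and $T$ are
  recovered as the real and the imaginary part of the eigenvalues of $S$; $E$ is real because
  $\mathrm{Re}$ is invariant under conjugation.
\<close>

subsection \<open>Unordered infinite products\<close>

text \<open>Absolute convergence makes the order of the factors immaterial. A finite set containing
  \<open>{..<N}\<close> changes the partial product \<open>P N\<close> by a factor whose distance
  from 1 is at most \<open>exp (t N) - 1\<close>, where \<open>t N\<close> is the tail of the series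
  of the distances \<open>d n\<close>.\<close>

lemma tendsto_prod_finite_subsets_at_top_nat:
  fixes g :: "nat \<Rightarrow> 'a :: {real_normed_field, banach}"
  assumes "abs_convergent_prod g"
  shows "(prod g \<longlongrightarrow> prodinf g) (finite_subsets_at_top UNIV)"
proof -
  define d where "d n = norm (g n - 1)" for n
  define P where "P N = prod g {..<N}" for N
  define t where "t N = (\<Sum>n. d (n + N))" for N
  have sd: "summable d"
    using assms unfolding d_def abs_convergent_prod_conv_summable .
  have P: "P \<longlonglongrightarrow> prodinf g"
  proof -
    have "(\<lambda>n. prod g {..n}) \<longlonglongrightarrow> prodinf g"
      using assms abs_convergent_prod_imp_convergent_prod convergent_prod_LIMSEQ by blast
    then show ?thesis
      by (subst filterlim_sequentially_Suc[symmetric]) (simp add: P_def lessThan_Suc_atMost)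
  qed
  have bound: "norm (prod g F - P N) \<le> norm (P N) * (exp (t N) - 1)"
    if F: "finite F" "{..<N} \<subseteq> F" for F N
  proof -
    have "prod g F = P N * prod g (F - {..<N})"
      unfolding P_def using F by (metis mult.commute prod.subset_diff)
    then have "norm (prod g F - P N) = norm (P N) * norm (prod g (F - {..<N}) - 1)"
      by (simp add: norm_mult[symmetric] algebra_simps)
    also have "norm (prod g (F - {..<N}) - 1) \<le> (\<Prod>n\<in>F - {..<N}. 1 + d n) - 1"
      using norm_prod_minus1_le_prod_minus1[of "\<lambda>n. g n - 1" "F - {..<N}"] by (simp add: d_def)
    also have "(\<Prod>n\<in>F - {..<N}. 1 + d n) \<le> exp (sum d (F - {..<N}))"
      by (rule prod_le_exp_sum) (simp add: d_def)
    also have "sum d (F - {..<N}) \<le> t N"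
    proof -
      \<comment> \<open>The part of \<open>F\<close> from \<open>N\<close> on is reindexed from 0,
        which makes it comparable with the shifted series \<open>t N\<close>.\<close>
      have eq: "F - {..<N} = (\<lambda>n. n + N) ` {n. n + N \<in> F}"
        by (auto simp: image_iff) (metis le_add_diff_inverse2 not_less)
      have fin: "finite {n. n + N \<in> F}"
        using finite_vimageI[OF F(1), of "\<lambda>n. n + N"] by (simp add: vimage_def)
      have "sum d (F - {..<N}) = (\<Sum>n | n + N \<in> F. d (n + N))"
        by (subst eq, subst sum.reindex) (auto simp: inj_on_def)
      also have "\<dots> \<le> t N"
        unfolding t_def
        by (rule sum_le_suminf[OF summable_ignore_initial_segment[OF sd] fin]) (simp add: d_def)
      finally show ?thesis .
    qed
    finally show ?thesis by (simp add: mult_left_mono)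
  qed
  have "t \<longlonglongrightarrow> 0"
    unfolding t_def using suminf_exist_split2[OF sd] .
  \<comment> \<open>The two summands are the distance of \<open>P N\<close> from the limit and the
    uniform bound for the distance of all larger finite products from \<open>P N\<close>.\<close>
  then have lim: "(\<lambda>N. norm (P N - prodinf g) + norm (P N) * (exp (t N) - 1)) \<longlonglongrightarrow>
      norm (prodinf g - prodinf g) + norm (prodinf g) * (exp 0 - 1)"
    by (intro tendsto_intros P)
  show ?thesis
  proof (rule tendstoI)
    fix e :: real assume "e > 0"
    with lim have "eventually (\<lambda>N. norm (P N - prodinf g) + norm (P N) * (exp (t N) - 1) < e) sequentially"
      by (auto dest: order_tendstoD)
    then obtain N where N: "norm (P N - prodinf g) + norm (P N) * (exp (t N) - 1) < e"
      by (meson eventually_happens sequentially_bot)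
    show "eventually (\<lambda>F. dist (prod g F) (prodinf g) < e) (finite_subsets_at_top UNIV)"
      unfolding eventually_finite_subsets_at_top
    proof (intro exI[of _ "{..<N}"] conjI allI impI)
      fix F :: "nat set" assume F: "finite F \<and> {..<N} \<subseteq> F \<and> F \<subseteq> UNIV"
      then have "norm (prod g F - P N) \<le> norm (P N) * (exp (t N) - 1)"
        using bound by blast
      moreover have "norm (prod g F - prodinf g) \<le> norm (prod g F - P N) + norm (P N - prodinf g)"
        by (rule order_trans[OF _ norm_triangle_ineq]) simp
      ultimately show "dist (prod g F) (prodinf g) < e"
        using N by (simp add: dist_norm)
    qed auto
  qed
qed

text \<open>Transport along the enumeration \<open>h\<close>: taking images under \<open>h\<close>
  carries the filter of finite sets of naturals to that of finite subsets of
  \<open>A\<close>.\<close>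

lemma tendsto_prod_finite_subsets_at_top:
  fixes g :: "'b \<Rightarrow> 'a :: {real_normed_field, banach}"
  assumes h: "bij_betw h (UNIV :: nat set) A" and g: "abs_convergent_prod (\<lambda>n. g (h n))"
  shows "(prod g \<longlongrightarrow> (\<Prod>n. g (h n))) (finite_subsets_at_top A)"
proof -
  have inj: "inj h" and A: "A = range h"
    using h by (auto simp: bij_betw_def)
  have "finite_subsets_at_top A = filtermap ((`) h) (finite_subsets_at_top UNIV)"
    using filtermap_image_finite_subsets_at_top[OF inj] A by simp
  moreover have "prod g (h ` F) = (\<Prod>n\<in>F. g (h n))" for F
    using inj by (subst prod.reindex) (auto simp: inj_on_def)
  ultimately show ?thesis
    using tendsto_prod_finite_subsets_at_top_nat[OF g] by (simp add: filterlim_filtermap)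
qed

subsection \<open>The sigma function of the lattice\<close>

text \<open>Near a zero of order 1 one has \<open>f w = g w * (w - z)\<close> with
  \<open>g z\<close> nonzero, and \<open>g z\<close> is the derivative. The point \<open>w\<close>
  guarantees that \<open>f\<close> is not identically zero.\<close>

lemma simple_zero_deriv_nonzero:
  assumes "f holomorphic_on UNIV" "f z = 0" "zorder f z = 1" "f w \<noteq> 0"
  shows "deriv f z \<noteq> 0"
proof -
  obtain r where r: "r > 0" "zor_poly f z holomorphic_on cball z r"
      "\<And>w. w \<in> cball z r \<Longrightarrow> f w = zor_poly f z w * (w - z) \<and> zor_poly f z w \<noteq> 0"
    using zorder_exist_zero[OF assms(1), of z] assms by (auto simp: Ball_def)
  define g where "g = zor_poly f z"
  have g: "g holomorphic_on ball z r"
    using r(2) by (auto simp: g_def intro: holomorphic_on_subset)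
  have "(g has_field_derivative deriv g z) (at z)"
    using g r(1) by (auto intro: holomorphic_derivI[of g "ball z r"])
  then have "((\<lambda>w. g w * (w - z)) has_field_derivative g z) (at z)"
    by (auto intro!: derivative_eq_intros)
  then have "(f has_field_derivative g z) (at z)"
    by (rule has_field_derivative_transform_within_open[of _ _ _ "ball z r"])
      (use r in \<open>auto simp: g_def\<close>)
  then show ?thesis
    using r(3)[of z] r(1) by (auto simp: g_def dest: DERIV_imp_deriv)
qed

section \<open>The lattice: Gaussian integers with real and imaginary part of equal parity\<close>

definition sigma_lattice :: "int \<times> int \<Rightarrow> complex" where
  "sigma_lattice k = of_int (fst k) * (1 - \<i>) + of_int (snd k) * (1 + \<i>)"

lemma Re_sigma_lattice [simp]: "Re (sigma_lattice k) = of_int (fst k + snd k)"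
  and Im_sigma_lattice [simp]: "Im (sigma_lattice k) = of_int (snd k - fst k)"
  by (simp_all add: sigma_lattice_def)

lemma norm_sigma_lattice:
  "norm (sigma_lattice k) ^ 2 = 2 * ((of_int (fst k))\<^sup>2 + (of_int (snd k))\<^sup>2)"
  by (simp only: cmod_power2 Re_sigma_lattice Im_sigma_lattice) (simp add: power2_eq_square algebra_simps)

lemma sigma_lattice_eq_0_iff [simp]: "sigma_lattice k = 0 \<longleftrightarrow> k = (0, 0)"
  by (cases k) (auto simp: complex_eq_iff)

lemma inj_sigma_lattice: "inj sigma_lattice"
  by (rule injI) (auto simp: complex_eq_iff prod_eq_iff)

text \<open>Real and imaginary part of a lattice point differ by twice the first index. This parity
  is what the fourth condition in \<open>sigma_pair\<close> expresses.\<close>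

lemma of_int_in_range_sigma_lattice:
  "complex_of_int m + \<i> * complex_of_int n \<in> range sigma_lattice \<longleftrightarrow> even (m - n)"
proof
  assume "complex_of_int m + \<i> * complex_of_int n \<in> range sigma_lattice"
  then obtain k where "complex_of_int m + \<i> * complex_of_int n = sigma_lattice k" by blast
  then have "m = fst k + snd k" "n = snd k - fst k"
    by (auto simp: complex_eq_iff simp flip: of_int_add of_int_diff)
  then show "even (m - n)" by simp
next
  assume "even (m - n)"
  then obtain j where "m = n + 2 * j" by (metis dvdE add.commute diff_add_cancel)
  then have "complex_of_int m + \<i> * complex_of_int n = sigma_lattice (j, n + j)"
    by (auto simp: complex_eq_iff)
  then show "complex_of_int m + \<i> * complex_of_int n \<in> range sigma_lattice" by blast
qed

text \<open>The integers are covered by the images of \<open>n\<close> and \<open>- n\<close>, and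
  each half is a shifted power series in the naturals.\<close>

lemma summable_on_int_powr:
  assumes "s < -1"
  shows "(\<lambda>k::int. (1 + real_of_int \<bar>k\<bar>) powr s) summable_on UNIV"
proof -
  have "summable (\<lambda>n::nat. (1 + real n) powr s)"
    using assms summable_real_powr_iff[of s]
    by (subst (asm) summable_Suc_iff[symmetric]) (simp add: add.commute)
  then have nat: "(\<lambda>n::nat. (1 + real n) powr s) summable_on UNIV"
    by (simp add: summable_on_UNIV_nonneg_real_iff)
  have "(\<lambda>k::int. (1 + real_of_int \<bar>k\<bar>) powr s) summable_on range int"
    using nat by (subst summable_on_reindex) (auto simp: o_def)
  moreover have "(\<lambda>k::int. (1 + real_of_int \<bar>k\<bar>) powr s) summable_on range (\<lambda>n. - int n)"
    using nat by (subst summable_on_reindex) (auto simp: o_def inj_on_def)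
  ultimately have "(\<lambda>k::int. (1 + real_of_int \<bar>k\<bar>) powr s) summable_on
      (range int \<union> range (\<lambda>n. - int n))"
    by (rule summable_on_union)
  also have "range int \<union> range (\<lambda>n. - int n) = UNIV"
    by (auto simp: image_iff) (metis int_cases2)
  finally show ?thesis .
qed

text \<open>For a nonzero lattice point of norm \<open>r\<close> with indices \<open>j\<close>,
  \<open>k\<close>, both \<open>1 + |j|\<close> and \<open>1 + |k|\<close> are at most
  \<open>2 * r\<close>. Splitting the exponent 3 evenly bounds the term by
  \<open>8 * (g j * g k)\<close>, a product of two convergent single series, since 3/2 exceeds
  1.\<close>

lemma summable_on_sigma_lattice:
  "(\<lambda>k. inverse (norm (sigma_lattice k)) ^ 3) summable_on (UNIV - {(0, 0)})"
proof -
  define g :: "int \<Rightarrow> real" where "g k = (1 + real_of_int \<bar>k\<bar>) powr (-3/2)" for k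
  have g: "g summable_on UNIV"
    unfolding g_def by (rule summable_on_int_powr) simp
  have g_nonneg: "g k \<ge> 0" for k by (simp add: g_def)
  have "(\<lambda>(j, k). 8 * (g j * g k)) summable_on UNIV \<times> UNIV"
    by (rule summable_on_SigmaI[where g = "\<lambda>j. 8 * (g j * infsum g UNIV)"])
      (use g in \<open>auto intro!: has_sum_cmult_right has_sum_infsum summable_on_cmult_right
        summable_on_cmult_left simp: g_nonneg\<close>)
  then have "(\<lambda>(j, k). 8 * (g j * g k)) summable_on (UNIV - {(0, 0)})"
    by (rule summable_on_subset_banach) auto
  then show ?thesis
  proof (rule summable_on_comparison_test)
    fix p :: "int \<times> int" assume "p \<in> UNIV - {(0, 0)}"
    then obtain j k where p: "p = (j, k)" "(j, k) \<noteq> (0, 0)" by (cases p) auto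
    define r where "r = norm (sigma_lattice p)"
    have r2: "r\<^sup>2 = 2 * ((real_of_int j)\<^sup>2 + (real_of_int k)\<^sup>2)"
      by (simp add: r_def norm_sigma_lattice p)
    have "1 \<le> j\<^sup>2 + k\<^sup>2"
      using p(2) by (smt (verit) sum_power2_gt_zero_iff prod.inject)
    then have "1 \<le> (real_of_int j)\<^sup>2 + (real_of_int k)\<^sup>2"
      by (metis of_int_1_le_iff of_int_add of_int_power)
    then have "1\<^sup>2 \<le> r\<^sup>2" "\<bar>real_of_int j\<bar>\<^sup>2 \<le> r\<^sup>2" "\<bar>real_of_int k\<bar>\<^sup>2 \<le> r\<^sup>2"
      unfolding r2 by simp_all
    moreover have "r \<ge> 0" by (simp add: r_def)
    ultimately have "1 \<le> r" "\<bar>real_of_int j\<bar> \<le> r" "\<bar>real_of_int k\<bar> \<le> r"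
      using power2_le_imp_le by blast+
    then have le: "1 + \<bar>real_of_int j\<bar> \<le> 2 * r" "1 + \<bar>real_of_int k\<bar> \<le> 2 * r" "r > 0"
      by auto
    have "(2 * r) powr (-3/2) \<le> g j" "(2 * r) powr (-3/2) \<le> g k"
      unfolding g_def using le by (auto intro!: powr_mono2')
    then have "(2 * r) powr (-3/2) * (2 * r) powr (-3/2) \<le> g j * g k"
      by (intro mult_mono) (auto simp: g_def)
    also have "(2 * r) powr (-3/2) * (2 * r) powr (-3/2) = (2 * r) powr (-3)"
      by (simp flip: powr_add)
    also have "\<dots> = inverse ((2 * r) ^ 3)"
      using le powr_realpow[of "2 * r" 3] by (simp add: powr_minus)
    finally have "inverse r ^ 3 \<le> 8 * (g j * g k)"
      by (simp add: power_mult_distrib power_inverse)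
    then show "inverse (norm (sigma_lattice p)) ^ 3 \<le> (case p of (j, k) \<Rightarrow> 8 * (g j * g k))"
      by (simp add: p r_def)
  qed auto
qed

section \<open>The sigma function as a Weierstrass product, and its zeros\<close>

abbreviation sigma_factor :: "complex \<Rightarrow> int \<times> int \<Rightarrow> complex" where
  "sigma_factor z k \<equiv> weierstrass_factor 2 (z / sigma_lattice k)"

text \<open>The factors in \<open>weierstrass_sigma\<close> are the Weierstrass elementary factors
  of genus 2.\<close>

lemma sigma_eq_Lim:
  "\<sigma> z = z * Lim (finite_subsets_at_top (UNIV - {(0, 0)})) (prod (sigma_factor z))"
proof -
  have "sum f {Suc 0..2} = f 1 + f 2" for f :: "nat \<Rightarrow> complex"
    by (simp add: eval_nat_numeral)
  then have "(\<lambda>(k\<^sub>1, k\<^sub>2). let u = z / (of_int k\<^sub>1 * (1 - \<i>) + of_int k\<^sub>2 * (1 + \<i>))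
              in (1 - u) * exp (u + (1 / 2) * u ^ 2)) = sigma_factor z"
    by (auto simp: fun_eq_iff weierstrass_factor_def sigma_lattice_def Let_def)
  then show ?thesis unfolding weierstrass_sigma_def by simp
qed

text \<open>The locale \<open>weierstrass_product\<close> takes a sequence of zeros, so the nonzero
  index pairs are enumerated. Any enumeration serves, by absolute convergence.\<close>

definition sigma_enum :: "nat \<Rightarrow> int \<times> int" where
  "sigma_enum = from_nat_into (UNIV - {(0, 0)})"

lemma bij_betw_sigma_enum: "bij_betw sigma_enum UNIV (UNIV - {(0, 0)})"
  unfolding sigma_enum_def
  by (intro bij_betw_from_nat_into) (auto simp: finite_prod infinite_UNIV_int)

text \<open>Constant genus 2 corresponds to summability of the inverse cubes. The same series shows
  that the lattice points tend to infinity, because its terms tend to 0.\<close>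

interpretation sigma_prod: weierstrass_product "\<lambda>n. sigma_lattice (sigma_enum n)" "\<lambda>_. 2"
proof
  show nz: "sigma_lattice (sigma_enum n) \<noteq> 0" for n
    using bij_betw_sigma_enum by (auto simp: bij_betw_def)
  have "(\<lambda>n. inverse (norm (sigma_lattice (sigma_enum n))) ^ 3) summable_on UNIV"
    using summable_on_sigma_lattice by (subst summable_on_reindex_bij_betw[OF bij_betw_sigma_enum])
  then have sum: "summable (\<lambda>n. inverse (norm (sigma_lattice (sigma_enum n))) ^ 3)"
    by (rule summable_on_imp_summable)
  show "summable (\<lambda>n. (r / norm (sigma_lattice (sigma_enum n))) ^ Suc 2)" for r
    using summable_mult[OF sum, of "r ^ 3"]
    by (simp add: divide_inverse power_mult_distrib numeral_3_eq_3 del: power_Suc)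
  have "(\<lambda>n. root 3 (inverse (norm (sigma_lattice (sigma_enum n))) ^ 3)) \<longlonglongrightarrow> root 3 0"
    using summable_LIMSEQ_zero[OF sum] by (intro tendsto_intros)
  then have "(\<lambda>n. inverse (norm (sigma_lattice (sigma_enum n)))) \<longlonglongrightarrow> 0"
    by (simp add: real_root_power_cancel)
  then have "(\<lambda>n. inverse (sigma_lattice (sigma_enum n))) \<longlonglongrightarrow> 0"
    by (simp add: norm_inverse[symmetric] tendsto_norm_zero_iff del: norm_inverse)
  then show "filterlim (\<lambda>n. sigma_lattice (sigma_enum n)) at_infinity sequentially"
    using nz by (simp add: filterlim_at flip: filterlim_inverse_at_iff)
qed

lemma tendsto_sigma_factor:
  "(prod (sigma_factor z) \<longlongrightarrow> sigma_prod.f z) (finite_subsets_at_top (UNIV - {(0, 0)}))"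
  unfolding sigma_prod.f_def
  by (rule tendsto_prod_finite_subsets_at_top[OF bij_betw_sigma_enum sigma_prod.abs_convergent])

lemma sigma_eq: "\<sigma> z = z * sigma_prod.f z"
  unfolding sigma_eq_Lim using tendsto_sigma_factor by (simp add: tendsto_Lim)

lemma holomorphic_sigma: "\<sigma> holomorphic_on A"
  unfolding sigma_eq [abs_def] by (intro holomorphic_intros sigma_prod.holomorphic)

lemma range_sigma_enum: "range (\<lambda>n. sigma_lattice (sigma_enum n)) = range sigma_lattice - {0}"
proof -
  have "range (\<lambda>n. sigma_lattice (sigma_enum n)) = sigma_lattice ` (UNIV - {(0, 0)})"
    using bij_betw_sigma_enum by (simp add: bij_betw_def flip: image_image)
  also have "\<dots> = range sigma_lattice - {0}"
    using image_set_diff[OF inj_sigma_lattice] by (simp add: sigma_lattice_def)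
  finally show ?thesis .
qed

lemma sigma_eq_0_iff: "\<sigma> z = 0 \<longleftrightarrow> z \<in> range sigma_lattice"
proof -
  have "0 \<in> range sigma_lattice" by (rule range_eqI[of _ _ "(0, 0)"]) simp
  then show ?thesis
    using range_sigma_enum by (auto simp: sigma_eq sigma_prod.zero)
qed

text \<open>By the product rule the derivative at 0 is the value of the product there, which is
  nonzero. At any other lattice point only \<open>z\<close> times the derivative of the product
  survives, and the product has a simple zero.\<close>

lemma deriv_sigma_nonzero:
  assumes "\<sigma> z = 0"
  shows "deriv \<sigma> z \<noteq> 0"
proof -
  have holo: "sigma_prod.f holomorphic_on UNIV" by (rule sigma_prod.holomorphic)
  have f0: "sigma_prod.f 0 \<noteq> 0" using range_sigma_enum by (subst sigma_prod.zero) blast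
  have "(sigma_prod.f has_field_derivative deriv sigma_prod.f z) (at z)"
    using holo by (auto intro: holomorphic_derivI)
  then have "(\<sigma> has_field_derivative (sigma_prod.f z + z * deriv sigma_prod.f z)) (at z)"
    unfolding sigma_eq [abs_def] by (auto intro!: derivative_eq_intros)
  then have deriv: "deriv \<sigma> z = sigma_prod.f z + z * deriv sigma_prod.f z"
    by (rule DERIV_imp_deriv)
  show ?thesis
  proof (cases "z = 0")
    case False
    then have z0: "sigma_prod.f z = 0" using assms by (simp add: sigma_eq)
    then obtain m where m: "z = sigma_lattice (sigma_enum m)"
      by (auto simp: sigma_prod.zero)
    \<comment> \<open>The order of a zero of the product is the number of indices at which it is
      enumerated; injectivity makes it 1.\<close>
    have "inj (\<lambda>n. sigma_lattice (sigma_enum n))"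
      using bij_betw_sigma_enum inj_compose[OF inj_sigma_lattice, of sigma_enum]
      by (simp add: bij_betw_def o_def)
    then have "(\<lambda>n. sigma_lattice (sigma_enum n)) -` {z} = {m}"
      using m by (auto simp: inj_def)
    then have "zorder sigma_prod.f z = 1" by (simp add: sigma_prod.zorder)
    then show ?thesis
      using simple_zero_deriv_nonzero[OF holo z0 _ f0] False z0 by (simp add: deriv)
  qed (use f0 deriv in simp)
qed

text \<open>Conjugation exchanges the two generators and so swaps the indices. The swap permutes the
  nonzero pairs, hence preserves the filter along which the product is taken.\<close>

lemma sigma_cnj: "\<sigma> (cnj z) = cnj (\<sigma> z)"
proof -
  let ?F = "finite_subsets_at_top (UNIV - {(0::int, 0::int)})"
  have swap: "sigma_factor (cnj z) k = cnj (sigma_factor z (prod.swap k))" for k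
    by (cases k) (simp add: weierstrass_factor_def sigma_lattice_def exp_cnj add.commute)
  have inj: "inj_on prod.swap A" for A :: "(int \<times> int) set"
    by (auto simp: inj_on_def prod.swap_def prod_eq_iff)
  have "prod.swap ` (UNIV - {(0::int, 0::int)}) = UNIV - {(0, 0)}"
    by (subst image_set_diff[OF inj]) simp
  then have "filtermap ((`) prod.swap) ?F = ?F"
    using filtermap_image_finite_subsets_at_top[OF inj] by metis
  then have "filterlim ((`) prod.swap) ?F ?F"
    by (simp add: filterlim_def)
  then have "((\<lambda>F. cnj (prod (sigma_factor z) (prod.swap ` F))) \<longlongrightarrow> cnj (sigma_prod.f z)) ?F"
    by (intro tendsto_cnj filterlim_compose[OF tendsto_sigma_factor])
  moreover have "cnj (prod (sigma_factor z) (prod.swap ` F)) = prod (sigma_factor (cnj z)) F" for F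
    by (subst prod.reindex[OF inj]) (simp add: swap o_def)
  ultimately have "(prod (sigma_factor (cnj z)) \<longlongrightarrow> cnj (sigma_prod.f z)) ?F" by simp
  then have "sigma_prod.f (cnj z) = cnj (sigma_prod.f z)"
    using tendsto_sigma_factor tendsto_unique finite_subsets_at_top_neq_bot by metis
  then show ?thesis by (simp add: sigma_eq)
qed

subsection \<open>Complexification\<close>

text \<open>The complexification of \<open>'v\<close> is \<open>'v \<times> 'v\<close>, the pair \<open>(x, y)\<close> standing for $x + \mathrm{i} y$.\<close>

definition cscale :: "complex \<Rightarrow> 'v::real_vector \<times> 'v \<Rightarrow> 'v \<times> 'v" (infixr "*\<^sub>C" 75) where
  "c *\<^sub>C u = (Re c *\<^sub>R fst u - Im c *\<^sub>R snd u, Re c *\<^sub>R snd u + Im c *\<^sub>R fst u)"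

interpretation cplx: vector_space cscale
  by unfold_locales (auto simp: cscale_def algebra_simps scaleR_diff_right scaleR_add_right)

interpretation cplx_pair: vector_space_pair cscale cscale
  by unfold_locales

abbreviation cmap :: "('v \<Rightarrow> 'v) \<Rightarrow> 'v \<times> 'v \<Rightarrow> 'v \<times> 'v" where
  "cmap A \<equiv> map_prod A A"

lemma linear_cmap:
  assumes "linear A"
  shows "Vector_Spaces.linear cscale cscale (cmap A)"
  unfolding Vector_Spaces.linear_iff
  by (auto simp: cplx.vector_space_axioms cscale_def linear_add[OF assms] linear_diff[OF assms]
    linear_scale[OF assms])

lemma funpow_cmap: "(cmap A ^^ k) u = ((A ^^ k) (fst u), (A ^^ k) (snd u))"
  by (induction k) auto

lemma cmap_eq_0_iff: "cmap A = (\<lambda>u. 0) \<longleftrightarrow> A = (\<lambda>v. 0)"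
  by (auto simp: fun_eq_iff zero_prod_def)

text \<open>The complex-linear extension of a real functional. It carries the weak convergence in
  \<open>fun_of_end\<close> over to the complexification.\<close>

definition cfunctional :: "('v::real_vector \<Rightarrow> real) \<Rightarrow> 'v \<times> 'v \<Rightarrow> complex" where
  "cfunctional \<phi> u = Complex (\<phi> (fst u)) (\<phi> (snd u))"

lemma cfunctional_add: "linear \<phi> \<Longrightarrow> cfunctional \<phi> (u + w) = cfunctional \<phi> u + cfunctional \<phi> w"
  by (simp add: cfunctional_def linear_add complex_eq_iff)

lemma cfunctional_cscale: "linear \<phi> \<Longrightarrow> cfunctional \<phi> (c *\<^sub>C u) = c * cfunctional \<phi> u"
  by (simp add: cfunctional_def cscale_def linear_add linear_diff linear_scale complex_eq_iff)

text \<open>A nonzero difference is an independent set, so some functional takes the value 1 on it.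
  Identities for \<open>fun_of_end\<close> are thereby read off from scalar series.\<close>

lemma linear_functionals_separate:
  fixes x y :: "'v::real_vector"
  assumes "\<And>\<phi>::'v \<Rightarrow> real. linear \<phi> \<Longrightarrow> \<phi> x = \<phi> y"
  shows "x = y"
proof (rule ccontr)
  assume "x \<noteq> y"
  then have "independent {x - y}" by simp
  then obtain \<phi> :: "'v \<Rightarrow> real" where "linear \<phi>" "\<phi> (x - y) = 1"
    using linear_independent_extend[of "{x - y}" "\<lambda>_. 1 :: real"] by auto
  then show False using assms[of \<phi>] by (simp add: linear_diff)
qed

lemma cfunctionals_separate:
  fixes u w :: "'v::real_vector \<times> 'v"
  assumes "\<And>\<phi>::'v \<Rightarrow> real. linear \<phi> \<Longrightarrow> cfunctional \<phi> u = cfunctional \<phi> w"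
  shows "u = w"
proof (rule prod_eqI)
  show "fst u = fst w"
    by (rule linear_functionals_separate) (metis assms cfunctional_def complex.inject)
  show "snd u = snd w"
    by (rule linear_functionals_separate) (metis assms cfunctional_def complex.inject)
qed

text \<open>This is p(A) u on the complexification, in Horner form with \<open>A\<close> applied to
  the argument.\<close>

definition poly_act :: "('v::real_vector \<Rightarrow> 'v) \<Rightarrow> complex poly \<Rightarrow> 'v \<times> 'v \<Rightarrow> 'v \<times> 'v" where
  "poly_act A p = fold_coeffs (\<lambda>c g u. c *\<^sub>C u + g (cmap A u)) p (\<lambda>u. 0)"

lemma poly_act_0 [simp]: "poly_act A 0 u = 0"
  by (simp add: poly_act_def)

lemma poly_act_pCons [simp]: "poly_act A (pCons c p) u = c *\<^sub>C u + poly_act A p (cmap A u)"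
  by (cases "c = 0 \<and> p = 0") (auto simp: poly_act_def)

lemma poly_act_add: "poly_act A (p + q) u = poly_act A p u + poly_act A q u"
  by (induction p q arbitrary: u rule: poly_induct2) (auto simp: cplx.scale_left_distrib)

lemma poly_act_smult: "poly_act A (smult c p) u = c *\<^sub>C poly_act A p u"
  by (induction p arbitrary: u) (auto simp: cplx.scale_right_distrib)

lemma poly_act_diff: "poly_act A (p - q) u = poly_act A p u - poly_act A q u"
  using poly_act_add[of A p "smult (- 1) q" u] by (simp only: poly_act_smult) simp

lemma poly_act_sum: "poly_act A (\<Sum>i\<in>I. p i) u = (\<Sum>i\<in>I. poly_act A (p i) u)"
  by (induction I rule: infinite_finite_induct) (auto simp: poly_act_add)

lemma poly_act_monom: "poly_act A (monom c k) u = c *\<^sub>C (cmap A ^^ k) u"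
  by (induction k arbitrary: u) (auto simp: monom_0 monom_Suc funpow_swap1)

lemma poly_act_linear_arg:
  assumes "linear A"
  shows "poly_act A p (u + w) = poly_act A p u + poly_act A p w"
    "poly_act A p (c *\<^sub>C u) = c *\<^sub>C poly_act A p u"
proof -
  note cA = linear_cmap[OF assms]
  show "poly_act A p (u + w) = poly_act A p u + poly_act A p w"
    by (induction p arbitrary: u w)
      (auto simp: cplx_pair.linear_add[OF cA] cplx.scale_right_distrib)
  show "poly_act A p (c *\<^sub>C u) = c *\<^sub>C poly_act A p u"
    by (induction p arbitrary: u)
      (auto simp: cplx_pair.linear_scale[OF cA] cplx.scale_right_distrib mult.commute)
qed

text \<open>Splitting off a root replaces \<open>u\<close> by its image under A - z, which drives
  the induction on the degree in \<open>subset_span_eigenvectors\<close>.\<close>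

lemma poly_act_linear_factor:
  assumes "linear A"
  shows "poly_act A ([:- z, 1:] * q) u = poly_act A q (cmap A u - z *\<^sub>C u)"
proof -
  have "[:- z, 1:] * q = pCons 0 q + smult (- z) q" by simp
  then have "poly_act A ([:- z, 1:] * q) u = poly_act A q (cmap A u) + (- z) *\<^sub>C poly_act A q u"
    by (simp only: poly_act_add poly_act_smult poly_act_pCons) simp
  also have "\<dots> = poly_act A q (cmap A u + (- z) *\<^sub>C u)"
    by (simp only: poly_act_linear_arg[OF assms])
  finally show ?thesis by simp
qed

lemma finite_cspan:
  assumes "\<exists>B :: 'v::real_vector set. finite B \<and> span B = UNIV"
  shows "\<exists>T :: ('v \<times> 'v) set. finite T \<and> cplx.span T = UNIV"
proof -
  obtain B :: "'v set" where B: "finite B" "span B = UNIV" using assms by blast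
  define T where "T = (\<lambda>b. (b, 0::'v)) ` B"
  have real: "(x, 0) \<in> cplx.span T" for x :: 'v
  proof -
    have "x \<in> span B" using B by simp
    then show ?thesis
    proof (induction x rule: span_induct_alt)
      case base
      then show ?case using cplx.span_zero[of T] by (simp add: zero_prod_def)
    next
      case (step c x y)
      have "of_real c *\<^sub>C (x, 0) + (y, 0) \<in> cplx.span T"
        using step cplx.span_base[of "(x, 0)" T] by (intro cplx.span_add cplx.span_scale) (simp_all add: T_def)
      moreover have "of_real c *\<^sub>C (x, 0) + (y, 0) = (c *\<^sub>R x + y, 0)"
        by (simp add: cscale_def)
      ultimately show ?case by simp
    qed
  qed
  have "u \<in> cplx.span T" for u
  proof -
    have "(fst u, 0) + \<i> *\<^sub>C (snd u, 0) \<in> cplx.span T"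
      by (intro cplx.span_add cplx.span_scale real)
    moreover have "(fst u, 0) + \<i> *\<^sub>C (snd u, 0) = u"
      by (simp add: cscale_def)
    ultimately show ?thesis by simp
  qed
  then have "cplx.span T = UNIV" by blast
  moreover have "finite T" using B(1) by (simp add: T_def)
  ultimately show ?thesis by blast
qed

text \<open>The iterates of \<open>A\<close> on \<open>u\<close> up to exponent
  \<open>card T\<close> are one more than the size of a spanning set. Either two of them coincide,
  or they are distinct and linearly dependent; both cases yield a polynomial.\<close>

lemma annihilating_poly:
  assumes "\<exists>B :: 'v::real_vector set. finite B \<and> span B = UNIV"
  shows "\<exists>p. p \<noteq> 0 \<and> poly_act A p (u :: 'v \<times> 'v) = 0"
proof -
  obtain T :: "('v \<times> 'v) set" where T: "finite T" "cplx.span T = UNIV"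
    using finite_cspan[OF assms] by blast
  define v where "v k = (cmap A ^^ k) u" for k
  show ?thesis
  proof (cases "inj_on v {..card T}")
    case False
    then obtain i j where ij: "i \<noteq> j" "v i = v j" by (auto simp: inj_on_def)
    then have "poly_act A (monom 1 i - monom 1 j) u = 0"
      by (simp add: poly_act_diff poly_act_monom v_def)
    moreover have "coeff (monom 1 i - monom 1 j :: complex poly) i \<noteq> 0"
      using ij by simp
    then have "monom 1 i - monom 1 j \<noteq> (0 :: complex poly)"
      by (metis coeff_0)
    ultimately show ?thesis by blast
  next
    case True
    then have "card (v ` {..card T}) = Suc (card T)" by (simp add: card_image)
    then have "cplx.dependent (v ` {..card T})"
      using cplx.independent_span_bound[of T "v ` {..card T}"] T by auto
    then obtain c where c: "\<exists>x\<in>v ` {..card T}. c x \<noteq> 0" "(\<Sum>x\<in>v ` {..card T}. c x *\<^sub>C x) = 0"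
      by (subst (asm) cplx.dependent_finite) auto
    define p where "p = (\<Sum>k\<in>{..card T}. monom (c (v k)) k)"
    have "poly_act A p u = (\<Sum>k\<in>{..card T}. c (v k) *\<^sub>C v k)"
      by (simp add: p_def poly_act_sum poly_act_monom v_def)
    also have "\<dots> = 0" using c(2) True by (simp add: sum.reindex)
    finally have "poly_act A p u = 0" .
    moreover obtain k where k: "k \<le> card T" "c (v k) \<noteq> 0" using c(1) by auto
    have "coeff p k = c (v k)"
      using k(1) by (simp add: p_def coeff_sum)
    with k have "p \<noteq> 0" by auto
    ultimately show ?thesis by blast
  qed
qed

subsection \<open>Eigenvectors and the functional calculus\<close>

text \<open>Conjugating all coefficients gives another expansion of \<open>f\<close> at 0, by the
  symmetry of \<open>f\<close>. Uniqueness of the expansion makes each coefficient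
  self-conjugate.\<close>

lemma fps_expansion_real:
  assumes f: "f holomorphic_on UNIV" and cnj: "\<And>z. f (cnj z) = cnj (f z)"
  shows "fps_nth (fps_expansion f 0) k \<in> \<real>"
proof -
  define F where "F = fps_expansion f 0"
  define G where "G = Abs_fps (\<lambda>n. cnj (fps_nth F n))"
  have F: "f has_fps_expansion F"
    unfolding F_def using f by (intro has_fps_expansion_fps_expansion[of UNIV]) auto
  have sums: "(\<lambda>n. fps_nth F n * z ^ n) sums f z" for z
    by (rule has_fps_expansion_imp_sums_complex[OF F, of \<infinity>]) (use f in auto)
  have sumsG: "(\<lambda>n. fps_nth G n * z ^ n) sums f z" for z
    using sums_cnj[THEN iffD2, OF sums[of "cnj z"]] by (simp add: G_def cnj)
  have "F = G"
  proof (rule fps_expansion_unique_complex[OF F])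
    have "fps_conv_radius G = fps_conv_radius F"
      by (simp add: fps_conv_radius_def conv_radius_def G_def)
    also have "\<dots> > 0" using F by (simp add: has_fps_expansion_def)
    finally show "f has_fps_expansion G"
      using sumsG by (auto simp: has_fps_expansion_def eval_fps_def sums_iff)
  qed
  then have "fps_nth F k = cnj (fps_nth F k)"
    by (metis G_def fps_nth_Abs_fps)
  then show ?thesis by (simp add: F_def Reals_cnj_iff)
qed

definition ceigenvectors :: "('v::real_vector \<Rightarrow> 'v) \<Rightarrow> complex set \<Rightarrow> ('v \<times> 'v) set" where
  "ceigenvectors A Z = {u. \<exists>\<mu>\<in>Z. cmap A u = \<mu> *\<^sub>C u}"

text \<open>These are the hypotheses of \<open>ex1_fun_of_end\<close>, under which the description
  in \<open>fun_of_end\<close> denotes the sum.\<close>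

locale functional_calculus =
  fixes f :: "complex \<Rightarrow> complex" and A :: "'v::real_vector \<Rightarrow> 'v"
  assumes findim: "\<exists>B :: 'v set. finite B \<and> span B = UNIV"
    and linear: "linear A"
    and holomorphic: "f holomorphic_on UNIV"
    and real_coeffs: "\<And>k. fps_nth (fps_expansion f 0) k \<in> \<real>"
begin

lemma fun_of_end_sums:
  assumes "linear \<phi>"
  shows "(\<lambda>k. fps_nth (fps_expansion f 0) k * complex_of_real (\<phi> ((A ^^ k) v)))
           sums complex_of_real (\<phi> (fun_of_end f A v))"
  using theI'[OF ex1_fun_of_end[OF findim linear holomorphic real_coeffs, of v]] assms
  by (simp add: fun_of_end_def)

lemma cfunctional_sums:
  assumes \<phi>: "linear \<phi>"
  shows "(\<lambda>k. fps_nth (fps_expansion f 0) k * cfunctional \<phi> ((cmap A ^^ k) u))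
           sums cfunctional \<phi> (cmap (fun_of_end f A) u)"
proof -
  have "(\<lambda>k. fps_nth (fps_expansion f 0) k * complex_of_real (\<phi> ((A ^^ k) (fst u))) +
        \<i> * (fps_nth (fps_expansion f 0) k * complex_of_real (\<phi> ((A ^^ k) (snd u)))))
      sums (complex_of_real (\<phi> (fun_of_end f A (fst u))) +
        \<i> * complex_of_real (\<phi> (fun_of_end f A (snd u))))"
    by (intro sums_add sums_mult fun_of_end_sums \<phi>)
  then show ?thesis
    by (simp add: cfunctional_def funpow_cmap Complex_eq algebra_simps)
qed

lemma linear_fun_of_end: "linear (fun_of_end f A)"
proof (rule linearI)
  have lin: "linear (A ^^ k)" for k
    by (induction k) (use linear in \<open>auto simp: linear_iff\<close>)
  show "fun_of_end f A (x + y) = fun_of_end f A x + fun_of_end f A y" for x y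
  proof (rule linear_functionals_separate)
    fix \<phi> :: "'v \<Rightarrow> real" assume \<phi>: "linear \<phi>"
    from sums_add[OF fun_of_end_sums[OF \<phi>, of x] fun_of_end_sums[OF \<phi>, of y]]
    have "(\<lambda>k. fps_nth (fps_expansion f 0) k * complex_of_real (\<phi> ((A ^^ k) (x + y))))
        sums complex_of_real (\<phi> (fun_of_end f A x + fun_of_end f A y))"
      by (simp add: linear_add[OF lin] linear_add[OF \<phi>] distrib_left)
    then show "\<phi> (fun_of_end f A (x + y)) = \<phi> (fun_of_end f A x + fun_of_end f A y)"
      using fun_of_end_sums[OF \<phi>, of "x + y"] sums_unique2 of_real_eq_iff by metis
  qed
  show "fun_of_end f A (c *\<^sub>R x) = c *\<^sub>R fun_of_end f A x" for c x
  proof (rule linear_functionals_separate)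
    fix \<phi> :: "'v \<Rightarrow> real" assume \<phi>: "linear \<phi>"
    from sums_mult[OF fun_of_end_sums[OF \<phi>, of x], of "of_real c"]
    have "(\<lambda>k. fps_nth (fps_expansion f 0) k * complex_of_real (\<phi> ((A ^^ k) (c *\<^sub>R x))))
        sums complex_of_real (\<phi> (c *\<^sub>R fun_of_end f A x))"
      by (simp add: linear_scale[OF lin] linear_scale[OF \<phi>] mult_ac)
    then show "\<phi> (fun_of_end f A (c *\<^sub>R x)) = \<phi> (c *\<^sub>R fun_of_end f A x)"
      using fun_of_end_sums[OF \<phi>, of "c *\<^sub>R x"] sums_unique2 of_real_eq_iff by metis
  qed
qed

lemma sums_f: "(\<lambda>k. fps_nth (fps_expansion f 0) k * z ^ k) sums f z"
  by (rule has_fps_expansion_imp_sums_complex[of _ _ \<infinity>])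
    (use holomorphic in \<open>auto intro: has_fps_expansion_fps_expansion[of UNIV]\<close>)

text \<open>Termwise differentiation, kept unshifted to match the powers of a Jordan block. At
  \<open>k = 0\<close> the exponent is truncated, but the factor \<open>of_nat k\<close>
  vanishes.\<close>

lemma sums_deriv_f: "(\<lambda>k. of_nat k * fps_nth (fps_expansion f 0) k * z ^ (k - 1)) sums deriv f z"
proof -
  define a where "a = fps_nth (fps_expansion f 0)"
  have summable: "summable (\<lambda>k. a k * w ^ k)" for w
    using sums_f by (auto simp: a_def sums_iff)
  have "((\<lambda>w. \<Sum>k. a k * w ^ k) has_field_derivative (\<Sum>k. diffs a k * z ^ k)) (at z)"
    by (rule termdiffs_strong[of _ "of_real (norm z + 1)"])
      (use summable in \<open>auto simp: add_nonneg_nonneg\<close>)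
  moreover have "(\<lambda>w. \<Sum>k. a k * w ^ k) = f"
    using sums_f by (auto simp: a_def sums_iff)
  ultimately have "deriv f z = (\<Sum>k. diffs a k * z ^ k)"
    by (auto intro: DERIV_imp_deriv)
  moreover have "summable (\<lambda>k. diffs a k * z ^ k)"
    by (rule termdiff_converges_all) (rule summable)
  ultimately show ?thesis
    using diffs_equiv[of a z] by (simp add: a_def)
qed

text \<open>The k-th power of \<open>A\<close> sends \<open>u\<close> to \<mu>^k u + k \<mu>^(k-1)
  w, so the series sums to the value and the derivative of \<open>f\<close> at \<mu>. The case
  \<open>w = 0\<close> covers eigenvectors.\<close>

lemma cmap_fun_of_end_Jordan:
  assumes u: "cmap A u = \<mu> *\<^sub>C u + w" and w: "cmap A w = \<mu> *\<^sub>C w"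
  shows "cmap (fun_of_end f A) u = f \<mu> *\<^sub>C u + deriv f \<mu> *\<^sub>C w"
proof (rule cfunctionals_separate)
  note cA = linear_cmap[OF linear]
  have pow: "(cmap A ^^ k) u = \<mu> ^ k *\<^sub>C u + (of_nat k * \<mu> ^ (k - 1)) *\<^sub>C w" for k
  proof (induction k)
    case (Suc k)
    have "(cmap A ^^ Suc k) u = \<mu> ^ Suc k *\<^sub>C u + (\<mu> ^ k + of_nat k * (\<mu> ^ (k - 1) * \<mu>)) *\<^sub>C w"
      by (simp add: Suc cplx_pair.linear_add[OF cA] cplx_pair.linear_scale[OF cA] u w
        cplx.scale_right_distrib cplx.scale_left_distrib mult_ac)
    also have "of_nat k * (\<mu> ^ (k - 1) * \<mu>) = of_nat k * \<mu> ^ k"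
      by (cases k) auto
    finally show ?case by (simp add: algebra_simps)
  qed simp
  fix \<phi> :: "'v \<Rightarrow> real" assume \<phi>: "linear \<phi>"
  have "(\<lambda>k. fps_nth (fps_expansion f 0) k * \<mu> ^ k * cfunctional \<phi> u +
        of_nat k * fps_nth (fps_expansion f 0) k * \<mu> ^ (k - 1) * cfunctional \<phi> w)
      sums (f \<mu> * cfunctional \<phi> u + deriv f \<mu> * cfunctional \<phi> w)"
    by (intro sums_add sums_mult2 sums_f sums_deriv_f)
  also have "(\<lambda>k. fps_nth (fps_expansion f 0) k * \<mu> ^ k * cfunctional \<phi> u +
        of_nat k * fps_nth (fps_expansion f 0) k * \<mu> ^ (k - 1) * cfunctional \<phi> w) =
      (\<lambda>k. fps_nth (fps_expansion f 0) k * cfunctional \<phi> ((cmap A ^^ k) u))"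
    by (simp add: pow cfunctional_add[OF \<phi>] cfunctional_cscale[OF \<phi>] algebra_simps)
  finally have "cfunctional \<phi> (cmap (fun_of_end f A) u) = f \<mu> * cfunctional \<phi> u + deriv f \<mu> * cfunctional \<phi> w"
    using cfunctional_sums[OF \<phi>, of u] sums_unique2 by blast
  then show "cfunctional \<phi> (cmap (fun_of_end f A) u) = cfunctional \<phi> (f \<mu> *\<^sub>C u + deriv f \<mu> *\<^sub>C w)"
    by (simp add: cfunctional_add[OF \<phi>] cfunctional_cscale[OF \<phi>])
qed

lemma cmap_fun_of_end_eigenvector:
  assumes "cmap A u = \<mu> *\<^sub>C u"
  shows "cmap (fun_of_end f A) u = f \<mu> *\<^sub>C u"
  using cmap_fun_of_end_Jordan[of u \<mu> 0] assms linear_0[OF linear] by (simp add: zero_prod_def cscale_def)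

lemma fun_of_end_eq_0I:
  assumes "cplx.span (ceigenvectors A {z. f z = 0}) = UNIV"
  shows "fun_of_end f A = (\<lambda>v. 0)"
proof -
  have "cmap (fun_of_end f A) u = 0" for u
  proof -
    have "u \<in> cplx.span (ceigenvectors A {z. f z = 0})" using assms by simp
    then show ?thesis
      by (rule cplx_pair.linear_eq_0_on_span[OF linear_cmap[OF linear_fun_of_end], rotated])
        (auto simp: ceigenvectors_def dest: cmap_fun_of_end_eigenvector)
  qed
  then show ?thesis using cmap_eq_0_iff by blast
qed

text \<open>Diagonalizability relative to an invariant subspace, so that one operator can be
  diagonalized on the eigenspaces of another. The span of eigenvectors in \<open>W\<close> absorbs
  \<open>u\<close> as soon as it contains (A - \<mu>) u, and an annihilating polynomial reduces
  everything to 0.\<close>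

lemma subset_span_eigenvectors:
  assumes zero: "fun_of_end f A = (\<lambda>v. 0)"
    and simple: "\<And>z. f z = 0 \<Longrightarrow> deriv f z \<noteq> 0"
    and W: "cplx.subspace W" and inv: "\<And>u. u \<in> W \<Longrightarrow> cmap A u \<in> W"
  shows "W \<subseteq> cplx.span (W \<inter> ceigenvectors A {z. f z = 0})"
proof -
  note cA = linear_cmap[OF linear]
  define X where "X = W \<inter> ceigenvectors A {z. f z = 0}"
  have fA0: "cmap (fun_of_end f A) u = 0" for u
    using zero cmap_eq_0_iff by metis
  have XW: "cplx.span X \<subseteq> W"
    using W by (intro cplx.span_minimal) (auto simp: X_def)
  \<comment> \<open>As \<open>A\<close> is diagonalizable on the span, each vector there is an image
    under A - \<mu> plus a vector killed by it.\<close>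
  have split: "\<exists>v\<in>cplx.span X. \<exists>y. x = (cmap A v - \<mu> *\<^sub>C v) + y \<and> cmap A y = \<mu> *\<^sub>C y"
    if "x \<in> cplx.span X" for x \<mu>
    using that
  proof (induction x rule: cplx.span_induct_alt)
    case base
    show ?case
      by (intro bexI[of _ 0] exI[of _ 0]) (auto simp: cplx.span_zero cplx_pair.linear_0[OF cA])
  next
    case (step c x r)
    then obtain v y where vy: "v \<in> cplx.span X" "r = (cmap A v - \<mu> *\<^sub>C v) + y" "cmap A y = \<mu> *\<^sub>C y"
      by blast
    obtain \<nu> where \<nu>: "cmap A x = \<nu> *\<^sub>C x" using step by (auto simp: X_def ceigenvectors_def)
    show ?case
    proof (cases "\<nu> = \<mu>")
      case True
      show ?thesis
        by (intro bexI[of _ v] exI[of _ "c *\<^sub>C x + y"])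
          (use vy \<nu> True in \<open>auto simp: cplx_pair.linear_add[OF cA] cplx_pair.linear_scale[OF cA]
            cplx.scale_right_distrib mult.commute\<close>)
    next
      case False
      \<comment> \<open>On the eigenvector \<open>x\<close>, A - \<mu> is multiplication by the
        nonzero number \<nu> - \<mu>, so \<open>d\<close> solves the equation for the summand
        \<open>c\<close> times \<open>x\<close>.\<close>
      define d where "d = c / (\<nu> - \<mu>)"
      have "cmap A (v + d *\<^sub>C x) - \<mu> *\<^sub>C (v + d *\<^sub>C x) = (cmap A v - \<mu> *\<^sub>C v) + (d * (\<nu> - \<mu>)) *\<^sub>C x"
        by (simp add: cplx_pair.linear_add[OF cA] cplx_pair.linear_scale[OF cA] \<nu>
          cplx.scale_right_distrib algebra_simps cplx.scale_left_diff_distrib)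
      also have "d * (\<nu> - \<mu>) = c" using False by (simp add: d_def)
      finally have "c *\<^sub>C x + r = (cmap A (v + d *\<^sub>C x) - \<mu> *\<^sub>C (v + d *\<^sub>C x)) + y"
        using vy(2) by (simp add: algebra_simps)
      moreover have "v + d *\<^sub>C x \<in> cplx.span X"
        using vy(1) cplx.span_base[OF step(1)] by (intro cplx.span_add cplx.span_scale)
      ultimately show ?thesis using vy(3) by blast
    qed
  qed
  have lift: "u \<in> cplx.span X" if u: "u \<in> W" "cmap A u - \<mu> *\<^sub>C u \<in> cplx.span X" for u \<mu>
  proof -
    obtain v y where vy: "v \<in> cplx.span X" "cmap A u - \<mu> *\<^sub>C u = (cmap A v - \<mu> *\<^sub>C v) + y"
        "cmap A y = \<mu> *\<^sub>C y"
      using split[OF u(2)] by blast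
    \<comment> \<open>Subtracting \<open>v\<close> leaves a Jordan chain of length at most two: A -
      \<mu> sends \<open>w\<close> to \<open>y\<close> and \<open>y\<close> to 0.\<close>
    define w where "w = u - v"
    have "w \<in> W" using u(1) vy(1) XW W by (auto simp: w_def intro: cplx.subspace_diff)
    have w: "cmap A w = \<mu> *\<^sub>C w + y"
      using vy(2) by (simp add: w_def cplx_pair.linear_diff[OF cA] cplx.scale_right_diff_distrib algebra_simps)
    have eq: "f \<mu> *\<^sub>C w + deriv f \<mu> *\<^sub>C y = 0"
      using cmap_fun_of_end_Jordan[OF w vy(3)] fA0 by simp
    have "f \<mu> *\<^sub>C y = 0"
      using cmap_fun_of_end_eigenvector[OF vy(3)] fA0 by simp
    \<comment> \<open>If \<open>f\<close> does not vanish at \<mu>, the preceding equation kills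
      \<open>y\<close>; otherwise the derivative is nonzero and \<open>eq\<close> does.\<close>
    then have "y = 0" using eq simple by (cases "f \<mu> = 0") auto
    then have "f \<mu> = 0 \<or> w = 0" using eq by simp
    then have "w \<in> cplx.span X"
    proof
      assume "f \<mu> = 0"
      then show ?thesis
        using w \<open>y = 0\<close> \<open>w \<in> W\<close> by (intro cplx.span_base) (auto simp: X_def ceigenvectors_def)
    qed (simp add: cplx.span_zero)
    then show ?thesis using vy(1) cplx.span_add by (fastforce simp: w_def)
  qed
  have "u \<in> cplx.span X" if "p \<noteq> 0" "poly_act A p u = 0" "u \<in> W" for p u
    using that
  proof (induction "degree p" arbitrary: p u)
    case 0
    then obtain c where "p = [:c:]" by (metis degree_eq_zeroE)
    then show ?case using 0 by (auto simp: cplx.span_zero)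
  next
    case (Suc n)
    then have "\<not> constant (poly p)" by (simp add: constant_degree)
    then obtain z where "poly p z = 0" using Fundamental_Theorem_Algebra.fundamental_theorem_of_algebra by blast
    then obtain q where q: "p = [:- z, 1:] * q" by (auto simp: poly_eq_0_iff_dvd)
    with Suc have "q \<noteq> 0" by auto
    then have "degree p = Suc (degree q)" using degree_mult_eq[of "[:- z, 1:]" q] by (simp only: q) simp
    moreover have "cmap A u - z *\<^sub>C u \<in> W"
      by (intro cplx.subspace_diff cplx.subspace_scale W inv Suc.prems)
    moreover have "poly_act A q (cmap A u - z *\<^sub>C u) = 0"
      using Suc.prems by (simp only: q poly_act_linear_factor[OF linear])
    ultimately have "cmap A u - z *\<^sub>C u \<in> cplx.span X"
      using Suc.hyps \<open>q \<noteq> 0\<close> by simp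
    with Suc.prems(3) show ?case by (rule lift)
  qed
  then show ?thesis using annihilating_poly[OF findim] by (metis X_def subsetI)
qed

end

lemma functional_calculusI:
  assumes "\<exists>B :: 'v::real_vector set. finite B \<and> span B = UNIV" and "linear (A :: 'v \<Rightarrow> 'v)"
    and "f holomorphic_on UNIV" and "\<And>z. f (cnj z) = cnj (f z)"
  shows "functional_calculus f A"
  using assms by (intro functional_calculus.intro fps_expansion_real)

section \<open>Sums, multiples and composites of endomorphisms on the complexification\<close>

lemma cmap_add: "cmap (\<lambda>v. A v + B v) u = cmap A u + cmap B u"
  by (cases u) simp

lemma cmap_diff: "cmap (\<lambda>v. A v - B v) u = cmap A u - cmap B u"
  by (cases u) simp

lemma cmap_scaleR: "cmap (\<lambda>v. c *\<^sub>R A v) u = of_real c *\<^sub>C cmap A u"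
  by (cases u) (simp add: cscale_def)

lemma cmap_comp: "cmap (\<lambda>v. A (B v)) u = cmap A (cmap B u)"
  by (cases u) simp

lemma cmap_power2: "cmap (\<lambda>v. (A ^^ 2) v) u = cmap A (cmap A u)"
  by (cases u) (simp add: numeral_2_eq_2)

lemma linear_scaleR_fun: "linear A \<Longrightarrow> linear (\<lambda>v. c *\<^sub>R A v)"
  by (simp add: linear_iff scaleR_add_right)

lemma linear_add_fun: "linear A \<Longrightarrow> linear B \<Longrightarrow> linear (\<lambda>v. A v + B v)"
  by (simp add: linear_iff scaleR_add_right)

lemma linear_power2_fun: "linear (A :: 'v::real_vector \<Rightarrow> 'v) \<Longrightarrow> linear (\<lambda>v. (A ^^ 2) v)"
  by (simp add: linear_iff numeral_2_eq_2)

subsection \<open>Joint eigenvectors\<close>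

lemma sinh_eq_0_iff: "sinh z = 0 \<longleftrightarrow> (\<exists>n::int. z = \<i> * of_real (of_int n * pi))" for z :: complex
proof
  assume "sinh z = 0"
  then obtain n :: int where "\<i> * z = of_real (of_int n * pi)"
    by (auto simp: sinh_conv_sin sin_eq_0)
  then have "z = \<i> * of_real (of_int (- n) * pi)"
    by (simp add: complex_eq_iff)
  then show "\<exists>n::int. z = \<i> * of_real (of_int n * pi)" by blast
next
  assume "\<exists>n::int. z = \<i> * of_real (of_int n * pi)"
  then obtain n :: int where "\<i> * z = of_real (of_int (- n) * pi)"
    by (auto simp: complex_eq_iff)
  then show "sinh z = 0" unfolding sinh_conv_sin using sin_eq_0 by auto
qed

lemma deriv_sin_nonzero: "sin z = 0 \<Longrightarrow> deriv sin z \<noteq> 0" for z :: complex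
  using sin_cos_squared_add[of z] by (auto simp: DERIV_imp_deriv[OF DERIV_sin])

lemma deriv_sinh_nonzero: "sinh z = 0 \<Longrightarrow> deriv sinh z \<noteq> 0" for z :: complex
proof -
  have "(sinh has_field_derivative cosh z) (at z)" by (auto intro!: derivative_eq_intros)
  then show "sinh z = 0 \<Longrightarrow> deriv sinh z \<noteq> 0"
    using hyperbolic_pythagoras[of z] by (auto dest: DERIV_imp_deriv)
qed

lemma holomorphic_sinh: "sinh holomorphic_on A"
  unfolding sinh_field_def by (intro holomorphic_intros) auto

lemma sinh_cnj: "sinh (cnj z) = cnj (sinh z)"
  by (simp add: sinh_field_def exp_cnj)

text \<open>The eigenvalue pairs are those allowed by the three equations with sin and sinh. For
  linear \<open>E\<close> and \<open>T\<close> the zero vector is included, which is harmless for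
  spans.\<close>

definition joint_eigenvectors :: "('v::real_vector \<Rightarrow> 'v) \<Rightarrow> ('v \<Rightarrow> 'v) \<Rightarrow> ('v \<times> 'v) set" where
  "joint_eigenvectors E T = {u. \<exists>m n :: int. even (m - n) \<and>
     cmap E u = of_int m *\<^sub>C u \<and> cmap T u = (\<i> * of_int n) *\<^sub>C u}"

lemma cmap_squares_joint:
  assumes "linear E" "linear T" "cmap E u = of_int m *\<^sub>C u" "cmap T u = (\<i> * of_int n) *\<^sub>C u"
  shows "cmap (\<lambda>v. (pi / 2) *\<^sub>R ((E ^^ 2) v + (T ^^ 2) v)) u
           = of_real ((pi / 2) * of_int (m\<^sup>2 - n\<^sup>2)) *\<^sub>C u"
proof -
  have "cmap (\<lambda>v. (E ^^ 2) v + (T ^^ 2) v) u = (of_int m * of_int m + (\<i> * of_int n) * (\<i> * of_int n)) *\<^sub>C u"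
    unfolding cmap_add cmap_power2
    by (simp only: assms cplx_pair.linear_scale[OF linear_cmap[OF assms(1)]]
        cplx_pair.linear_scale[OF linear_cmap[OF assms(2)]] cplx.scale_scale cplx.scale_left_distrib)
  also have "of_int m * of_int m + (\<i> * of_int n) * (\<i> * of_int n) = of_real (of_int (m\<^sup>2 - n\<^sup>2))"
    by (simp add: power2_eq_square complex_eq_iff)
  finally show ?thesis
    by (simp only: cmap_scaleR cplx.scale_scale of_real_mult)
qed

text \<open>The zeros of sin are the integer multiples of pi, so the difference of squares must be
  even; a square has the parity of its base.\<close>

lemma sin_half_pi_eq_0_iff:
  "sin (complex_of_real ((pi / 2) * of_int (m\<^sup>2 - n\<^sup>2))) = 0 \<longleftrightarrow> even (m - n)" for m n :: int
proof -
  have "sin (complex_of_real ((pi / 2) * of_int (m\<^sup>2 - n\<^sup>2))) = 0 \<longleftrightarrow>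
      (\<exists>k::int. (pi / 2) * of_int (m\<^sup>2 - n\<^sup>2) = of_int k * pi)"
    by (simp only: sin_eq_0 of_real_eq_iff)
  also have "\<dots> \<longleftrightarrow> (\<exists>k::int. real_of_int (m\<^sup>2 - n\<^sup>2) = of_int (2 * k))"
  proof -
    have "(pi / 2) * x = y * pi \<longleftrightarrow> x = 2 * y" for x y :: real by (auto simp: field_simps)
    then show ?thesis by simp
  qed
  also have "\<dots> \<longleftrightarrow> even (m\<^sup>2 - n\<^sup>2)"
    unfolding of_int_eq_iff by (auto simp: dvd_def)
  finally show ?thesis by simp
qed

text \<open>First \<open>E\<close> is diagonalized on the whole space. Each eigenspace
  \<open>W m\<close> is stable under \<open>T\<close> because the two commute, so \<open>T\<close>
  is diagonalized on it. The last condition then gives the parity.\<close>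

lemma span_joint_eigenvectors:
  assumes findim: "\<exists>B :: 'v::real_vector set. finite B \<and> span B = UNIV"
    and E: "linear (E :: 'v \<Rightarrow> 'v)" and T: "linear T" and pair: "sigma_pair E T"
  shows "cplx.span (joint_eigenvectors E T) = UNIV"
proof -
  let ?Q = "\<lambda>v. (pi / 2) *\<^sub>R ((E ^^ 2) v + (T ^^ 2) v)"
  define J where "J = joint_eigenvectors E T"
  define W where "W m = {u. cmap E u = of_int m *\<^sub>C u}" for m :: int
  interpret E: functional_calculus sin "\<lambda>v. pi *\<^sub>R E v"
    by (intro functional_calculusI findim linear_scaleR_fun E) (auto intro: holomorphic_intros simp: cnj_sin)
  interpret T: functional_calculus sinh "\<lambda>v. pi *\<^sub>R T v"
    by (intro functional_calculusI findim linear_scaleR_fun T) (auto intro: holomorphic_sinh simp: sinh_cnj)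
  interpret Q: functional_calculus sin ?Q
    by (intro functional_calculusI findim linear_scaleR_fun linear_add_fun linear_power2_fun E T)
      (auto intro: holomorphic_intros simp: cnj_sin)
  have "E (T v) - T (E v) = 0" for v
    using pair unfolding sigma_pair_def by meson
  then have comm: "cmap E (cmap T u) = cmap T (cmap E u)" for u
    by (cases u) auto
  have unscale: "cmap A u = \<mu> *\<^sub>C u" if "cmap (\<lambda>v. pi *\<^sub>R A v) u = (\<mu> * of_real pi) *\<^sub>C u" 
    for A and u :: "'v \<times> 'v" and \<mu>
  proof -
    have "of_real pi *\<^sub>C cmap A u = of_real pi *\<^sub>C (\<mu> *\<^sub>C u)"
      using that by (simp add: cmap_scaleR mult.commute)
    then show ?thesis by (simp only: cplx.scale_cancel_left) simp
  qed
  have WJ: "W m \<subseteq> cplx.span J" for m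
  proof -
    have "W m \<subseteq> cplx.span (W m \<inter> ceigenvectors (\<lambda>v. pi *\<^sub>R T v) {z. sinh z = 0})"
    proof (rule T.subset_span_eigenvectors)
      show "fun_of_end sinh (\<lambda>v. pi *\<^sub>R T v) = (\<lambda>v. 0)"
        using pair by (simp add: sigma_pair_def)
      show "cplx.subspace (W m)"
        by (rule cplx.subspaceI) (auto simp: W_def cplx_pair.linear_0[OF linear_cmap[OF E]]
          cplx_pair.linear_add[OF linear_cmap[OF E]] cplx_pair.linear_scale[OF linear_cmap[OF E]]
          cplx.scale_right_distrib mult.commute)
      show "cmap (\<lambda>v. pi *\<^sub>R T v) u \<in> W m" if "u \<in> W m" for u
        using that by (auto simp: W_def cmap_scaleR comm cplx_pair.linear_scale[OF linear_cmap[OF E]]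
          cplx_pair.linear_scale[OF linear_cmap[OF T]] mult.commute)
    qed (rule deriv_sinh_nonzero)
    also have "W m \<inter> ceigenvectors (\<lambda>v. pi *\<^sub>R T v) {z. sinh z = 0} \<subseteq> J"
    proof
      fix u assume u: "u \<in> W m \<inter> ceigenvectors (\<lambda>v. pi *\<^sub>R T v) {z. sinh z = 0}"
      then obtain n :: int where n: "cmap (\<lambda>v. pi *\<^sub>R T v) u = (\<i> * of_real (of_int n * pi)) *\<^sub>C u"
        unfolding ceigenvectors_def sinh_eq_0_iff by blast
      have Tu: "cmap T u = (\<i> * of_int n) *\<^sub>C u"
        by (rule unscale) (simp only: n of_real_mult of_real_of_int_eq mult.assoc)
      have Eu: "cmap E u = of_int m *\<^sub>C u" using u by (simp add: W_def)
      show "u \<in> J"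
      \<comment> \<open>Only a nonzero vector forces the sine of its eigenvalue to vanish; the zero
        vector is placed in \<open>J\<close> with \<open>m = n = 0\<close>.\<close>
      proof (cases "u = 0")
        case True
        then show ?thesis
          by (auto simp: J_def joint_eigenvectors_def cplx_pair.linear_0[OF linear_cmap[OF E]]
            cplx_pair.linear_0[OF linear_cmap[OF T]] intro: exI[of _ 0])
      next
        case False
        have "cmap (fun_of_end sin ?Q) u = sin (of_real ((pi / 2) * of_int (m\<^sup>2 - n\<^sup>2))) *\<^sub>C u"
          by (intro Q.cmap_fun_of_end_eigenvector cmap_squares_joint E T Eu Tu)
        moreover have "cmap (fun_of_end sin ?Q) u = 0"
          using pair cmap_eq_0_iff unfolding sigma_pair_def by metis
        ultimately have "even (m - n)"
          using False by (simp only: sin_half_pi_eq_0_iff[symmetric]) (metis cplx.scale_eq_0_iff)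
        then show ?thesis using Eu Tu by (auto simp: J_def joint_eigenvectors_def)
      qed
    qed
    finally show ?thesis using cplx.span_mono by blast
  qed
  have "UNIV \<subseteq> cplx.span (UNIV \<inter> ceigenvectors (\<lambda>v. pi *\<^sub>R E v) {z. sin z = 0})"
    by (rule E.subset_span_eigenvectors)
      (use pair deriv_sin_nonzero in \<open>auto simp: sigma_pair_def\<close>)
  also have "\<dots> \<subseteq> cplx.span J"
  proof (rule cplx.span_minimal)
    show "UNIV \<inter> ceigenvectors (\<lambda>v. pi *\<^sub>R E v) {z. sin z = 0} \<subseteq> cplx.span J"
    proof
      fix u assume "u \<in> UNIV \<inter> ceigenvectors (\<lambda>v. pi *\<^sub>R E v) {z. sin z = 0}"
      then obtain m :: int where m: "cmap (\<lambda>v. pi *\<^sub>R E v) u = of_real (of_int m * pi) *\<^sub>C u"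
        unfolding ceigenvectors_def sin_eq_0 by blast
      have "cmap E u = of_int m *\<^sub>C u"
        by (rule unscale) (simp only: m of_real_mult of_real_of_int_eq)
      then have "u \<in> W m" by (simp add: W_def)
      then show "u \<in> cplx.span J" using WJ by blast
    qed
  qed (rule cplx.subspace_span)
  finally show ?thesis by (simp add: J_def top.extremum_uniqueI)
qed

text \<open>Each condition says that a linear map is zero, which is checked on the spanning joint
  eigenvectors.\<close>

lemma sigma_pair_if_span_joint_eigenvectors:
  assumes findim: "\<exists>B :: 'v::real_vector set. finite B \<and> span B = UNIV"
    and E: "linear (E :: 'v \<Rightarrow> 'v)" and T: "linear T"
    and span: "cplx.span (joint_eigenvectors E T) = UNIV"
  shows "sigma_pair E T"
proof -
  let ?Q = "\<lambda>v. (pi / 2) *\<^sub>R ((E ^^ 2) v + (T ^^ 2) v)"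
  interpret E: functional_calculus sin "\<lambda>v. pi *\<^sub>R E v"
    by (intro functional_calculusI findim linear_scaleR_fun E) (auto intro: holomorphic_intros simp: cnj_sin)
  interpret T: functional_calculus sinh "\<lambda>v. pi *\<^sub>R T v"
    by (intro functional_calculusI findim linear_scaleR_fun T) (auto intro: holomorphic_sinh simp: sinh_cnj)
  interpret Q: functional_calculus sin ?Q
    by (intro functional_calculusI findim linear_scaleR_fun linear_add_fun linear_power2_fun E T)
      (auto intro: holomorphic_intros simp: cnj_sin)
  have spanI: "cplx.span X = UNIV" if "joint_eigenvectors E T \<subseteq> X" for X
    using cplx.span_mono[OF that] span by auto
  define D where "D v = E (T v) - T (E v)" for v
  have D: "linear D"
    by (rule linearI) (simp_all add: D_def linear_add[OF E] linear_add[OF T] linear_scale[OF E]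
      linear_scale[OF T] scaleR_diff_right)
  have "cmap D u = 0" for u
  proof (rule cplx_pair.linear_eq_0_on_span[OF linear_cmap[OF D]])
    show "u \<in> cplx.span (joint_eigenvectors E T)" by (simp add: span)
    show "cmap D x = 0" if "x \<in> joint_eigenvectors E T" for x
      using that unfolding D_def cmap_diff cmap_comp joint_eigenvectors_def
      by (auto simp: cplx_pair.linear_scale[OF linear_cmap[OF E]]
          cplx_pair.linear_scale[OF linear_cmap[OF T]] mult.commute)
  qed
  then have "D = (\<lambda>v. 0)" using cmap_eq_0_iff by blast
  moreover have "fun_of_end sin (\<lambda>v. pi *\<^sub>R E v) = (\<lambda>v. 0)"
  proof (rule E.fun_of_end_eq_0I, rule spanI, rule subsetI)
    fix u assume "u \<in> joint_eigenvectors E T"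
    then obtain m :: int where "cmap E u = of_int m *\<^sub>C u" by (auto simp: joint_eigenvectors_def)
    then have "cmap (\<lambda>v. pi *\<^sub>R E v) u = of_real (of_int m * pi) *\<^sub>C u"
      by (simp add: cmap_scaleR mult.commute)
    then show "u \<in> ceigenvectors (\<lambda>v. pi *\<^sub>R E v) {z. sin z = 0}"
      unfolding ceigenvectors_def sin_eq_0 by blast
  qed
  moreover have "fun_of_end sinh (\<lambda>v. pi *\<^sub>R T v) = (\<lambda>v. 0)"
  proof (rule T.fun_of_end_eq_0I, rule spanI, rule subsetI)
    fix u assume "u \<in> joint_eigenvectors E T"
    then obtain n :: int where "cmap T u = (\<i> * of_int n) *\<^sub>C u" by (auto simp: joint_eigenvectors_def)
    then have "cmap (\<lambda>v. pi *\<^sub>R T v) u = (\<i> * of_real (of_int n * pi)) *\<^sub>C u"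
      by (simp add: cmap_scaleR mult_ac)
    then show "u \<in> ceigenvectors (\<lambda>v. pi *\<^sub>R T v) {z. sinh z = 0}"
      unfolding ceigenvectors_def sinh_eq_0_iff by blast
  qed
  moreover have "fun_of_end sin ?Q = (\<lambda>v. 0)"
  proof (rule Q.fun_of_end_eq_0I, rule spanI, rule subsetI)
    fix u assume "u \<in> joint_eigenvectors E T"
    then obtain m n :: int where "even (m - n)" "cmap E u = of_int m *\<^sub>C u" "cmap T u = (\<i> * of_int n) *\<^sub>C u"
      by (auto simp: joint_eigenvectors_def)
    then show "u \<in> ceigenvectors ?Q {z. sin z = 0}"
      unfolding ceigenvectors_def using cmap_squares_joint[OF E T] sin_half_pi_eq_0_iff by blast
  qed
  ultimately show ?thesis
    unfolding sigma_pair_def D_def by blast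
qed

lemma joint_eigenvectors_subset_sigma:
  "joint_eigenvectors E T \<subseteq> ceigenvectors (\<lambda>v. E v + T v) {z. \<sigma> z = 0}"
proof
  fix u assume "u \<in> joint_eigenvectors E T"
  then obtain m n :: int where mn: "even (m - n)" "cmap E u = of_int m *\<^sub>C u" "cmap T u = (\<i> * of_int n) *\<^sub>C u"
    by (auto simp: joint_eigenvectors_def)
  then have "cmap (\<lambda>v. E v + T v) u = (of_int m + \<i> * of_int n) *\<^sub>C u"
    by (simp add: cmap_add cplx.scale_left_distrib)
  then show "u \<in> ceigenvectors (\<lambda>v. E v + T v) {z. \<sigma> z = 0}"
    using mn(1) unfolding ceigenvectors_def sigma_eq_0_iff
    by (intro CollectI bexI[of _ "of_int m + \<i> * of_int n"])
      (simp_all only: of_int_in_range_sigma_lattice mem_Collect_eq)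
qed

subsection \<open>Functions of a diagonalizable endomorphism\<close>

lemma self_eq_neg: "x = - x \<Longrightarrow> x = 0" for x :: "'v::real_vector"
  by (metis add.right_inverse scaleR_2 scaleR_eq_0_iff zero_neq_numeral)

text \<open>Here \<open>g\<close> is an arbitrary function of the eigenvalue, not a power series, so
  \<open>Q\<close> is prescribed on a basis of eigenvectors. Any other eigenvector involves only
  basis vectors with its own eigenvalue.\<close>

lemma eigenvalue_map:
  assumes S: "linear (S :: 'v::real_vector \<Rightarrow> 'v)" and span: "cplx.span (ceigenvectors S Z) = UNIV"
  obtains Q where "Vector_Spaces.linear cscale cscale Q"
    "\<And>u \<mu>. cmap S u = \<mu> *\<^sub>C u \<Longrightarrow> Q u = g \<mu> *\<^sub>C u"
proof -
  note cS = linear_cmap[OF S]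
  obtain B where B: "B \<subseteq> ceigenvectors S Z" "cplx.independent B" "ceigenvectors S Z \<subseteq> cplx.span B"
    using cplx.maximal_independent_subset by blast
  have spB: "cplx.span B = UNIV"
    using B(3) span cplx.span_minimal cplx.subspace_span by (metis top.extremum_uniqueI)
  have "\<forall>b\<in>B. \<exists>\<mu>. cmap S b = \<mu> *\<^sub>C b" using B(1) by (auto simp: ceigenvectors_def)
  then obtain ev where ev: "\<And>b. b \<in> B \<Longrightarrow> cmap S b = ev b *\<^sub>C b" by metis
  obtain Q where Q: "Vector_Spaces.linear cscale cscale Q" "\<And>b. b \<in> B \<Longrightarrow> Q b = g (ev b) *\<^sub>C b"
    using cplx_pair.linear_independent_extend[OF B(2), of "\<lambda>b. g (ev b) *\<^sub>C b"] by blast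
  have "Q u = g \<mu> *\<^sub>C u" if u: "cmap S u = \<mu> *\<^sub>C u" for u \<mu>
  proof -
    have "u \<in> cplx.span B" by (simp add: spB)
    then obtain t r where t: "finite t" "t \<subseteq> B" and ur: "u = (\<Sum>b\<in>t. r b *\<^sub>C b)"
      unfolding cplx.span_explicit by blast
    \<comment> \<open>This expands (S - \<mu>) u = 0 in the basis, so independence removes every
      coefficient with an eigenvalue other than \<mu>.\<close>
    have "(\<Sum>b\<in>t. (r b * (ev b - \<mu>)) *\<^sub>C b) = (\<Sum>b\<in>t. r b *\<^sub>C cmap S b) - \<mu> *\<^sub>C u"
      unfolding ur cplx.scale_sum_right sum_subtractf[symmetric] using t(2)
      by (intro sum.cong refl) (simp only: ev subset_iff cplx.scale_scale right_diff_distrib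
        cplx.scale_left_diff_distrib mult.commute[of \<mu>])
    also have "(\<Sum>b\<in>t. r b *\<^sub>C cmap S b) = cmap S u"
      by (simp add: ur cplx_pair.linear_sum[OF cS] cplx_pair.linear_scale[OF cS])
    finally have "(\<Sum>b\<in>t. (r b * (ev b - \<mu>)) *\<^sub>C b) = 0" using u by simp
    from cplx.independentD[OF B(2) t this]
    have "r b = 0 \<or> ev b = \<mu>" if "b \<in> t" for b using that by auto
    then have "r b *\<^sub>C Q b = g \<mu> *\<^sub>C r b *\<^sub>C b" if "b \<in> t" for b
      using t(2) Q(2)[of b] that by (metis cplx.scale_left_commute cplx.scale_zero_left cplx.scale_zero_right subsetD)
    then have "(\<Sum>b\<in>t. r b *\<^sub>C Q b) = (\<Sum>b\<in>t. g \<mu> *\<^sub>C r b *\<^sub>C b)"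
      by (rule sum.cong[OF refl])
    then show ?thesis
      by (simp add: ur cplx_pair.linear_sum[OF Q(1)] cplx_pair.linear_scale[OF Q(1)] cplx.scale_sum_right)
  qed
  with Q(1) show ?thesis by (rule that)
qed

section \<open>Complex conjugation and descent to real endomorphisms\<close>

definition cconj :: "'v::real_vector \<times> 'v \<Rightarrow> 'v \<times> 'v" where
  "cconj u = (fst u, - snd u)"

lemma cconj_cconj [simp]: "cconj (cconj u) = u"
  by (simp add: cconj_def)

lemma cconj_add: "cconj (u + w) = cconj u + cconj w"
  by (simp add: cconj_def)

lemma cconj_cscale: "cconj (c *\<^sub>C u) = cnj c *\<^sub>C cconj u"
  by (simp add: cconj_def cscale_def)

lemma cmap_cconj: "linear S \<Longrightarrow> cmap S (cconj u) = cconj (cmap S u)"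
  by (cases u) (simp add: cconj_def linear_neg)

text \<open>Conjugating an eigenvector of the real map \<open>S\<close> conjugates its eigenvalue.
  By the symmetry of \<open>g\<close>, the map \<open>Q\<close> agrees with its conjugate
  \<open>K\<close> on eigenvectors, hence everywhere, and so preserves real vectors.\<close>

lemma eigenvalue_map_real:
  assumes S: "linear (S :: 'v::real_vector \<Rightarrow> 'v)" and span: "cplx.span (ceigenvectors S Z) = UNIV"
    and g: "\<And>\<mu>. g (cnj \<mu>) = cnj (g \<mu>)"
  obtains E where "linear E" "\<And>u \<mu>. cmap S u = \<mu> *\<^sub>C u \<Longrightarrow> cmap E u = g \<mu> *\<^sub>C u"
proof -
  obtain Q where Q: "Vector_Spaces.linear cscale cscale Q"
      "\<And>u \<mu>. cmap S u = \<mu> *\<^sub>C u \<Longrightarrow> Q u = g \<mu> *\<^sub>C u"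
    using eigenvalue_map[OF S span] by blast
  define K where "K u = cconj (Q (cconj u))" for u
  have K: "Vector_Spaces.linear cscale cscale K"
    unfolding Vector_Spaces.linear_iff
    by (auto simp: cplx.vector_space_axioms K_def cconj_add cconj_cscale
      cplx_pair.linear_add[OF Q(1)] cplx_pair.linear_scale[OF Q(1)])
  have KQ: "K u = Q u" for u
  proof (rule cplx_pair.linear_eq_on[OF K Q(1)])
    show "u \<in> cplx.span (ceigenvectors S Z)" by (simp add: span)
    fix b assume "b \<in> ceigenvectors S Z"
    then obtain \<mu> where \<mu>: "cmap S b = \<mu> *\<^sub>C b" by (auto simp: ceigenvectors_def)
    then have "cmap S (cconj b) = cnj \<mu> *\<^sub>C cconj b"
      by (simp add: cmap_cconj[OF S] cconj_cscale)
    then have "Q (cconj b) = g (cnj \<mu>) *\<^sub>C cconj b" by (rule Q(2))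
    then show "K b = Q b" using Q(2)[OF \<mu>] by (simp add: K_def cconj_cscale g)
  qed
  define E where "E x = fst (Q (x, 0))" for x
  have Q_real: "Q (x, 0) = (E x, 0)" for x
  proof -
    have "snd (Q (x, 0)) = - snd (Q (x, 0))"
      using KQ[of "(x, 0)"] by (metis K_def cconj_def fst_conv snd_conv neg_0_equal_iff_equal)
    then have "snd (Q (x, 0)) = 0" by (rule self_eq_neg)
    then show ?thesis by (simp add: E_def prod_eq_iff)
  qed
  have "linear E"
  proof (rule linearI)
    show "E (x + y) = E x + E y" for x y
      using cplx_pair.linear_add[OF Q(1), of "(x, 0)" "(y, 0)"] by (simp add: E_def)
    show "E (c *\<^sub>R x) = c *\<^sub>R E x" for c x
      using cplx_pair.linear_scale[OF Q(1), of "of_real c" "(x, 0)"] by (simp add: E_def cscale_def)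
  qed
  moreover have "cmap E u = Q u" for u
  proof -
    have "Q u = Q ((fst u, 0) + \<i> *\<^sub>C (snd u, 0))"
      by (simp add: cscale_def)
    also have "\<dots> = (E (fst u), 0) + \<i> *\<^sub>C (E (snd u), 0)"
      by (simp only: cplx_pair.linear_add[OF Q(1)] cplx_pair.linear_scale[OF Q(1)] Q_real)
    finally show ?thesis by (cases u) (simp add: cscale_def)
  qed
  ultimately show ?thesis using that Q(2) by simp
qed

subsection \<open>The correspondence\<close>

theorem theorem3p1:
  assumes findim: "\<exists>B :: 'v::real_vector set. finite B \<and> span B = UNIV"
  shows "(\<forall>E T :: 'v \<Rightarrow> 'v. linear E \<and> linear T \<and> sigma_pair E T \<longrightarrow>
            fun_of_end \<sigma> (\<lambda>v. E v + T v) = (\<lambda>v. 0))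
       \<and> (\<forall>S :: 'v \<Rightarrow> 'v. linear S \<and> fun_of_end \<sigma> S = (\<lambda>v. 0) \<longrightarrow>
            (\<exists>!p. linear (fst p) \<and> linear (snd p) \<and>
                  S = (\<lambda>v. fst p v + snd p v) \<and> sigma_pair (fst p) (snd p)))"
proof (intro conjI allI impI)
  fix E T :: "'v \<Rightarrow> 'v" assume "linear E \<and> linear T \<and> sigma_pair E T"
  then have ET: "linear E" "linear T" "sigma_pair E T" by auto
  interpret S: functional_calculus \<sigma> "\<lambda>v. E v + T v"
    by (intro functional_calculusI findim linear_add_fun ET holomorphic_sigma sigma_cnj)
  show "fun_of_end \<sigma> (\<lambda>v. E v + T v) = (\<lambda>v. 0)"
    using cplx.span_mono[OF joint_eigenvectors_subset_sigma] span_joint_eigenvectors[OF findim ET]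
    by (intro S.fun_of_end_eq_0I) blast
next
  fix S :: "'v \<Rightarrow> 'v" assume "linear S \<and> fun_of_end \<sigma> S = (\<lambda>v. 0)"
  then have S: "linear S" and zero: "fun_of_end \<sigma> S = (\<lambda>v. 0)" by auto
  interpret S: functional_calculus \<sigma> S
    by (intro functional_calculusI findim S holomorphic_sigma sigma_cnj)
  have "UNIV \<subseteq> cplx.span (UNIV \<inter> ceigenvectors S {z. \<sigma> z = 0})"
    by (rule S.subset_span_eigenvectors[OF zero deriv_sigma_nonzero]) auto
  then have span: "cplx.span (ceigenvectors S {z. \<sigma> z = 0}) = UNIV" by auto
  \<comment> \<open>The real part is invariant under conjugation but not holomorphic, hence
    \<open>eigenvalue_map_real\<close> rather than \<open>fun_of_end\<close>.\<close>
  obtain E where E: "linear E" "\<And>u \<mu>. cmap S u = \<mu> *\<^sub>C u \<Longrightarrow> cmap E u = of_real (Re \<mu>) *\<^sub>C u"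
    using eigenvalue_map_real[OF S span, of "\<lambda>\<mu>. of_real (Re \<mu>)"] by auto
  define T where "T v = S v - E v" for v
  have T: "linear T"
    using S E(1) by (auto simp: T_def linear_iff scaleR_diff_right)
  have "ceigenvectors S {z. \<sigma> z = 0} \<subseteq> joint_eigenvectors E T"
  proof
    fix u assume "u \<in> ceigenvectors S {z. \<sigma> z = 0}"
    then obtain \<mu> where \<mu>: "cmap S u = \<mu> *\<^sub>C u" "\<mu> \<in> range sigma_lattice"
      by (auto simp: ceigenvectors_def sigma_eq_0_iff)
    then obtain k where k: "\<mu> = sigma_lattice k" by blast
    define m n where "m = fst k + snd k" and "n = snd k - fst k"
    have \<mu>_eq: "\<mu> = of_int m + \<i> * of_int n"
      by (simp add: k complex_eq_iff m_def n_def)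
    have Eu: "cmap E u = of_int m *\<^sub>C u"
      using E(2)[OF \<mu>(1)] by (simp add: \<mu>_eq)
    moreover have "cmap T u = (\<i> * of_int n) *\<^sub>C u"
      unfolding T_def cmap_diff by (simp add: \<mu>(1) Eu) (simp add: \<mu>_eq cplx.scale_left_distrib)
    moreover have "even (m - n)" by (simp add: m_def n_def)
    ultimately show "u \<in> joint_eigenvectors E T" by (auto simp: joint_eigenvectors_def)
  qed
  then have "cplx.span (joint_eigenvectors E T) = UNIV"
    using cplx.span_mono span by blast
  then have pair: "sigma_pair E T"
    by (rule sigma_pair_if_span_joint_eigenvectors[OF findim E(1) T])
  show "\<exists>!p. linear (fst p) \<and> linear (snd p) \<and>
      S = (\<lambda>v. fst p v + snd p v) \<and> sigma_pair (fst p) (snd p)"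
  proof (rule ex1I[of _ "(E, T)"])
    show "linear (fst (E, T)) \<and> linear (snd (E, T)) \<and>
      S = (\<lambda>v. fst (E, T) v + snd (E, T) v) \<and> sigma_pair (fst (E, T)) (snd (E, T))"
      using E(1) T pair by (auto simp: T_def)
  next
    fix p assume "linear (fst p) \<and> linear (snd p) \<and>
      S = (\<lambda>v. fst p v + snd p v) \<and> sigma_pair (fst p) (snd p)"
    then obtain E' T' where p: "p = (E', T')" "linear E'" "linear T'"
        "S = (\<lambda>v. E' v + T' v)" "sigma_pair E' T'"
      by (cases p) auto
    \<comment> \<open>A joint eigenvector of the competing pair is an eigenvector of
      \<open>S\<close> with eigenvalue m + i n. On it \<open>E\<close> acts by the real part
      \<open>m\<close>, just as \<open>E'\<close> does, and such vectors span.\<close>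
    have "cmap E' u = cmap E u" for u
    proof (rule cplx_pair.linear_eq_on[OF linear_cmap[OF p(2)] linear_cmap[OF E(1)]])
      show "u \<in> cplx.span (joint_eigenvectors E' T')"
        using span_joint_eigenvectors[OF findim p(2,3,5)] by simp
      fix b assume "b \<in> joint_eigenvectors E' T'"
      then obtain m n :: int where b: "cmap E' b = of_int m *\<^sub>C b" "cmap T' b = (\<i> * of_int n) *\<^sub>C b"
        by (auto simp: joint_eigenvectors_def)
      then have "cmap S b = (of_int m + \<i> * of_int n) *\<^sub>C b"
        by (simp add: p(4) cmap_add cplx.scale_left_distrib)
      from E(2)[OF this] show "cmap E' b = cmap E b" by (simp add: b)
    qed
    then have "E' = E" by (auto simp: fun_eq_iff)
    moreover from this have "T' = T" by (simp add: T_def p(4) fun_eq_iff)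
    ultimately show "p = (E, T)" by (simp add: p(1))
  qed
qed

end
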